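(* Let $M$ be a compact smooth manifold and let $\mathcal G$ be an arbitrary subgroup of the group $\mathrm{Diff}^\infty(M)$ of $C^\infty$ diffeomorphisms of $M$ (no further regularity of $\mathcal G$ is assumed). Then the set $\mathcal T_o\mathcal G$ of vector fields tangent to $\mathcal G$ is a Lie subalgebra of the Lie algebra $\mathfrak X^\infty(M)$ of smooth vector fields on $M$.
   Context: $\mathrm{Diff}^\infty(M)$ is regarded as an infinite-dimensional (Fréchet) Lie group; a curve $t\mapsto\varphi_t$ in it is $C^\infty$-smooth with respect to this structure (for compact $M$, equivalently $(t,p)\mapsto\varphi_t(p)$ is smooth). $\mathfrak X^\infty(M)$ is the Lie algebra of $C^\infty$ vector fields on $M$ with the usual bracket. For an integer $k\ge 1$, a smooth curve $c\colon I\to M$ ($I\subset\mathbb R$ an interval containing $0$) with $c(0)=p$ is a $k$-th order integral curve of $v\in T_pM$ if all its derivatives of orders $1,\dots,k-1$ vanish at $t=0$ and its $k$-th derivative at $0$ (which is then a well-defined tangent vector at $p$) equals $v$. A $C^\infty$-smooth curve $\varphi\colon I\to\mathrm{Diff}^\infty(M)$, $t\mapsto\varphi_t$, is an integral curve of $X\in\mathfrak X^\infty(M)$ if $\varphi_0=\mathrm{id}_M$ and there is an integer $k\ge1$ (the order of the curve) such that for every $p\in M$ the curve $t\mapsto\varphi_t(p)$ is a $k$-th order integral curve of $X(p)$, i.e. $\partial_t^i\varphi_t|_{t=0}=0$ for $1\le i<k$ and $\partial_t^k\varphi_t|_{t=0}=X$. $X\in\mathfrak X^\infty(M)$ is tangent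 to a subgroup $\mathcal G\subset\mathrm{Diff}^\infty(M)$ if there is an integral curve $\varphi_t$ of $X$ with $\varphi_t\in\mathcal G$ for all $t\in I$. The set of vector fields tangent to $\mathcal G$ is denoted $\mathcal T_o\mathcal G$. *)

theory Defs
  imports "HOL-Analysis.Analysis" "HOL-Algebra.Group"
begin

section \<open>Smoothness in normed spaces\<close>

text \<open>Derivatives are taken within the set \<open>S\<close>. Below, \<open>S\<close> is always open, or relatively open
  in \<open>I\<close> or in \<open>I \<times> E\<close> with \<open>I\<close> a nondegenerate interval and \<open>E\<close> a Euclidean space; on such sets
  derivatives within \<open>S\<close> are unique, and they are one-sided in time at an end point of \<open>I\<close>.\<close>

primrec Ck_on :: "nat \<Rightarrow> 'a::real_normed_vector set \<Rightarrow> ('a \<Rightarrow> 'b::real_normed_vector) \<Rightarrow> bool" where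
  "Ck_on 0 S f \<longleftrightarrow> continuous_on S f"
| "Ck_on (Suc k) S f \<longleftrightarrow> f differentiable_on S \<and>
     (\<forall>v. Ck_on k S (\<lambda>x. frechet_derivative f (at x within S) v))"

definition smooth_on :: "'a::real_normed_vector set \<Rightarrow> ('a \<Rightarrow> 'b::real_normed_vector) \<Rightarrow> bool" where
  "smooth_on S f \<longleftrightarrow> (\<forall>k. Ck_on k S f)"

definition nth_deriv :: "real set \<Rightarrow> nat \<Rightarrow> (real \<Rightarrow> real) \<Rightarrow> real \<Rightarrow> real" where
  "nth_deriv I n g = ((\<lambda>h t. vector_derivative h (at t within I)) ^^ n) g"


section \<open>Smooth manifolds\<close>

text \<open>The underlying space of the manifold is the whole type \<open>'m\<close>, assumed Hausdorff and second
  countable in the theorem; the smooth structure is given by an atlas \<open>A\<close>, not necessarily maximal.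
  Manifolds are without boundary. In a chart \<open>(U, x)\<close> only the values of \<open>x\<close> on \<open>U\<close> matter.\<close>

type_synonym ('m, 'e) chart = "'m set \<times> ('m \<Rightarrow> 'e)"

definition is_chart :: "('m::topological_space, 'e::euclidean_space) chart \<Rightarrow> bool" where
  "is_chart c \<longleftrightarrow> (case c of (U, x) \<Rightarrow>
     open U \<and> open (x ` U) \<and> homeomorphism U (x ` U) x (inv_into U x))"

definition smooth_atlas :: "('m::topological_space, 'e::euclidean_space) chart set \<Rightarrow> bool" where
  "smooth_atlas A \<longleftrightarrow> (\<forall>c\<in>A. is_chart c) \<and> (\<Union>c\<in>A. fst c) = UNIV \<and>
     (\<forall>(U, x)\<in>A. \<forall>(V, y)\<in>A. smooth_on (x ` (U \<inter> V)) (\<lambda>z. y (inv_into U x z)))"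

definition smooth_functions ::
    "('m::topological_space, 'e::euclidean_space) chart set \<Rightarrow> ('m \<Rightarrow> real) set" where
  "smooth_functions A = {f. \<forall>(U, x)\<in>A. smooth_on (x ` U) (\<lambda>z. f (inv_into U x z))}"

definition smooth_map ::
    "('m::topological_space, 'e::euclidean_space) chart set \<Rightarrow> ('m \<Rightarrow> 'm) \<Rightarrow> bool" where
  "smooth_map A f \<longleftrightarrow> continuous_on UNIV f \<and>
     (\<forall>(U, x)\<in>A. \<forall>(V, y)\<in>A. smooth_on (x ` (U \<inter> f -` V)) (\<lambda>z. y (f (inv_into U x z))))"

definition smooth_curve ::
    "('m::topological_space, 'e::euclidean_space) chart set \<Rightarrow> real set \<Rightarrow> (real \<Rightarrow> 'm) \<Rightarrow> bool" where
  "smooth_curve A I c \<longleftrightarrow> continuous_on I c \<and>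
     (\<forall>(U, x)\<in>A. smooth_on {t\<in>I. c t \<in> U} (\<lambda>t. x (c t)))"


section \<open>The diffeomorphism group and its smooth curves\<close>

definition diff_group ::
    "('m::topological_space, 'e::euclidean_space) chart set \<Rightarrow> ('m \<Rightarrow> 'm) monoid" where
  "diff_group A =
     \<lparr>carrier = {f. bij f \<and> smooth_map A f \<and> smooth_map A (inv_into UNIV f)}, mult = (\<circ>), one = id\<rparr>"

text \<open>For a compact manifold, a curve in the Frechet Lie group of diffeomorphisms is smooth iff
  \<open>(t, p) \<mapsto> \<phi>\<^sub>t(p)\<close> is smooth on \<open>I \<times> M\<close>.\<close>

definition smooth_diff_curve ::
    "('m::topological_space, 'e::euclidean_space) chart set \<Rightarrow> real set \<Rightarrow> (real \<Rightarrow> 'm \<Rightarrow> 'm) \<Rightarrow> bool"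
  where
  "smooth_diff_curve A I \<phi> \<longleftrightarrow>
     (\<forall>t\<in>I. \<phi> t \<in> carrier (diff_group A)) \<and>
     continuous_on (I \<times> UNIV) (\<lambda>(t, p). \<phi> t p) \<and>
     (\<forall>(U, x)\<in>A. \<forall>(V, y)\<in>A.
        smooth_on {(t, z). t \<in> I \<and> z \<in> x ` U \<and> \<phi> t (inv_into U x z) \<in> V}
          (\<lambda>(t, z). y (\<phi> t (inv_into U x z))))"


section \<open>Tangent vectors and vector fields\<close>

text \<open>Tangent vectors at \<open>p\<close> are the derivations at \<open>p\<close> of the algebra of smooth functions. As
  HOL functions they are total; the value 0 on non-smooth arguments makes equality of tangent
  vectors coincide with HOL equality, and is preserved by the operations below.\<close>

definition tangent_space ::
    "('m::topological_space, 'e::euclidean_space) chart set \<Rightarrow> 'm \<Rightarrow> (('m \<Rightarrow> real) \<Rightarrow> real) set" where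
  "tangent_space A p = {v.
     (\<forall>f\<in>smooth_functions A. \<forall>g\<in>smooth_functions A. v (\<lambda>q. f q + g q) = v f + v g) \<and>
     (\<forall>a. \<forall>f\<in>smooth_functions A. v (\<lambda>q. a * f q) = a * v f) \<and>
     (\<forall>f\<in>smooth_functions A. \<forall>g\<in>smooth_functions A.
        v (\<lambda>q. f q * g q) = f p * v g + g p * v f) \<and>
     (\<forall>f. f \<notin> smooth_functions A \<longrightarrow> v f = 0)}"

type_synonym 'm vfield = "'m \<Rightarrow> ('m \<Rightarrow> real) \<Rightarrow> real"

definition vector_fields ::
    "('m::topological_space, 'e::euclidean_space) chart set \<Rightarrow> 'm vfield set" where
  "vector_fields A = {X. (\<forall>p. X p \<in> tangent_space A p) \<and>
     (\<forall>f\<in>smooth_functions A. (\<lambda>p. X p f) \<in> smooth_functions A)}"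

definition vf_zero :: "'m vfield" where
  "vf_zero = (\<lambda>p f. 0)"

definition vf_add :: "'m vfield \<Rightarrow> 'm vfield \<Rightarrow> 'm vfield" where
  "vf_add X Y = (\<lambda>p f. X p f + Y p f)"

definition vf_scale :: "real \<Rightarrow> 'm vfield \<Rightarrow> 'm vfield" where
  "vf_scale a X = (\<lambda>p f. a * X p f)"

definition vf_bracket :: "'m vfield \<Rightarrow> 'm vfield \<Rightarrow> 'm vfield" where
  "vf_bracket X Y = (\<lambda>p f. X p (\<lambda>q. Y q f) - Y p (\<lambda>q. X q f))"

definition lie_subalgebra ::
    "('m::topological_space, 'e::euclidean_space) chart set \<Rightarrow> 'm vfield set \<Rightarrow> bool" where
  "lie_subalgebra A L \<longleftrightarrow> L \<subseteq> vector_fields A \<and> vf_zero \<in> L \<and>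
     (\<forall>X\<in>L. \<forall>Y\<in>L. vf_add X Y \<in> L) \<and>
     (\<forall>a. \<forall>X\<in>L. vf_scale a X \<in> L) \<and>
     (\<forall>X\<in>L. \<forall>Y\<in>L. vf_bracket X Y \<in> L)"


section \<open>Higher-order integral curves\<close>

definition interval_about_0 :: "real set \<Rightarrow> bool" where
  "interval_about_0 I \<longleftrightarrow> is_interval I \<and> 0 \<in> I \<and> I \<noteq> {0}"

text \<open>The \<open>i\<close>-th derivative of \<open>c\<close> at 0 acts on smooth functions by \<open>f \<mapsto> (f \<circ> c)\<^sup>(\<^sup>i\<^sup>)(0)\<close>. This is a
  derivation at \<open>c 0\<close>, that is, a tangent vector, when the derivatives of orders \<open>1, \<dots>, i - 1\<close>
  vanish.\<close>

definition curve_deriv_0 ::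
    "('m::topological_space, 'e::euclidean_space) chart set \<Rightarrow> real set \<Rightarrow> (real \<Rightarrow> 'm) \<Rightarrow> nat \<Rightarrow>
     ('m \<Rightarrow> real) \<Rightarrow> real" where
  "curve_deriv_0 A I c i =
     (\<lambda>f. if f \<in> smooth_functions A then nth_deriv I i (\<lambda>t. f (c t)) 0 else 0)"

definition kth_order_integral_curve ::
    "('m::topological_space, 'e::euclidean_space) chart set \<Rightarrow> nat \<Rightarrow> real set \<Rightarrow> (real \<Rightarrow> 'm) \<Rightarrow>
     'm \<Rightarrow> (('m \<Rightarrow> real) \<Rightarrow> real) \<Rightarrow> bool" where
  "kth_order_integral_curve A k I c p v \<longleftrightarrow>
     interval_about_0 I \<and> smooth_curve A I c \<and> c 0 = p \<and> v \<in> tangent_space A p \<and>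
     (\<forall>i. 1 \<le> i \<and> i < k \<longrightarrow> curve_deriv_0 A I c i = (\<lambda>f. 0)) \<and> curve_deriv_0 A I c k = v"

definition integral_curve ::
    "('m::topological_space, 'e::euclidean_space) chart set \<Rightarrow> real set \<Rightarrow> (real \<Rightarrow> 'm \<Rightarrow> 'm) \<Rightarrow>
     'm vfield \<Rightarrow> bool" where
  "integral_curve A I \<phi> X \<longleftrightarrow>
     interval_about_0 I \<and> smooth_diff_curve A I \<phi> \<and> \<phi> 0 = id \<and>
     (\<exists>k\<ge>1. \<forall>p. kth_order_integral_curve A k I (\<lambda>t. \<phi> t p) p (X p))"

definition tangent_fields ::
    "('m::topological_space, 'e::euclidean_space) chart set \<Rightarrow> ('m \<Rightarrow> 'm) set \<Rightarrow> 'm vfield set" where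
  "tangent_fields A G =
     {X \<in> vector_fields A. \<exists>I \<phi>. integral_curve A I \<phi> X \<and> (\<forall>t\<in>I. \<phi> t \<in> G)}"

end

theory Submission imports Defs begin

text \<open>A family \<open>\<phi>\<^sub>t\<close> with \<open>\<phi>\<^sub>0 = id\<close> is an integral curve of \<open>X\<close> of order \<open>k\<close> iff
  \<open>(f(\<phi>\<^sub>t q) - f(q)) / t\<^sup>k\<close> tends to \<open>(Xf)(p) / k!\<close> as \<open>(t, q) \<rightarrow> (0, p)\<close>, for all smooth \<open>f\<close> and all
  \<open>p\<close>. Substituting \<open>b t\<^sup>l\<close> for \<open>t\<close> rescales \<open>X\<close> by a positive factor and multiplies the order by \<open>l\<close>,
  so two curves in the group may be assumed to have a common order \<open>k\<close> and to be defined on a common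
  interval \<open>[0, d]\<close>. Then \<open>\<phi>\<^sub>t \<circ> \<psi>\<^sub>t\<close> has order \<open>k\<close> and generates the sum, the inverse \<open>\<phi>\<^sub>t\<^sup>-\<^sup>1\<close> generates
  \<open>-X\<close>, and the commutator of \<open>\<phi>\<^sub>t\<close> and \<open>\<psi>\<^sub>t\<close> has order \<open>2k\<close> and generates a multiple of the bracket,
  because in \<open>f(\<phi>\<^sub>t(\<psi>\<^sub>t q)) - f(\<psi>\<^sub>t(\<phi>\<^sub>t q))\<close> all terms below \<open>t\<^sup>2\<^sup>k\<close> cancel. Compactness makes
  \<open>(t, p) \<mapsto> \<phi>\<^sub>t\<^sup>-\<^sup>1(p)\<close> continuous, after which it is smooth by differentiating the inverse.\<close>

section \<open>Calculus of smooth maps\<close>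

text \<open>Differentiating composites k or 2k times directly would call for the higher chain rule
  in charts, with many mixed terms. A limit over the filter
  \<open>(at 0 within I) \<times>\<^sub>F nhds p\<close> replaces it: a family with
  \<open>\<phi> 0 = id\<close> carries this filter into itself, so an expansion of one factor may be
  evaluated at a point moved by another, and sums, inverses and commutators become telescoping
  identities. Tangent vectors are tested on globally smooth functions; charts serve for smoothness
  and continuity, not for writing down the expansions. The time interval may have 0 as an end point.
  Hence derivatives are one-sided and the calculus is developed on sets that need not be open. For
  the same reason \<open>-X\<close> comes from inverse diffeomorphisms: time reversal may leave the
  interval, and for even order it does not change the sign.\<close>

declare Ck_on.simps(2) [simp del]

text \<open>Approach along every coordinate direction, from at least one side, suffices for
  uniqueness of a derivative within the set. Open sets have this property, and so do products of
  time intervals with chart images, where 0 may be an end point of the interval.\<close>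

definition accessible :: "'a::euclidean_space set \<Rightarrow> bool" where
  "accessible S \<longleftrightarrow>
     (\<forall>x\<in>S. \<forall>i\<in>Basis. \<forall>e>0. \<exists>d. 0 < \<bar>d\<bar> \<and> \<bar>d\<bar> < e \<and> x + d *\<^sub>R i \<in> S)"

lemma accessible_derivative_unique:
  assumes "accessible S" "x \<in> S"
    and "(f has_derivative D) (at x within S)" "(f has_derivative D') (at x within S)"
  shows "D = D'"
  using assms by (intro frechet_derivative_unique_within[of f D x S D']) (auto simp: accessible_def)

lemma accessible_frechet_derivative:
  assumes "accessible S" "x \<in> S" "(f has_derivative D) (at x within S)"
  shows "frechet_derivative f (at x within S) = D"
proof -
  have "f differentiable at x within S"
    using assms(3) by (auto simp: differentiable_def)
  then show ?thesis
    using accessible_derivative_unique[OF assms(1,2) _ assms(3)] frechet_derivative_works by blast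
qed

lemma accessible_Int_open:
  assumes "accessible S" "open N"
  shows "accessible (S \<inter> N)"
  unfolding accessible_def
proof (intro ballI allI impI)
  fix x i :: 'a and e :: real
  assume x: "x \<in> S \<inter> N" and i: "i \<in> Basis" and e: "0 < e"
  obtain r where r: "r > 0" "ball x r \<subseteq> N"
    using assms(2) x openE by blast
  obtain d where d: "0 < \<bar>d\<bar>" "\<bar>d\<bar> < min e r" "x + d *\<^sub>R i \<in> S"
    using assms(1) x i e r(1) unfolding accessible_def
    by (metis IntD1 min_less_iff_conj)
  have "x + d *\<^sub>R i \<in> ball x r"
    using d i by (simp add: dist_norm)
  then show "\<exists>d. 0 < \<bar>d\<bar> \<and> \<bar>d\<bar> < e \<and> x + d *\<^sub>R i \<in> S \<inter> N"
    using d r by auto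
qed

lemma accessible_UNIV: "accessible (UNIV :: 'a::euclidean_space set)"
  unfolding accessible_def
proof (intro ballI allI impI)
  fix x i :: 'a and e :: real
  assume "0 < e"
  then show "\<exists>d. 0 < \<bar>d\<bar> \<and> \<bar>d\<bar> < e \<and> x + d *\<^sub>R i \<in> UNIV"
    by (intro exI[of _ "e/2"]) auto
qed

lemma accessible_open: "open N \<Longrightarrow> accessible N"
  using accessible_Int_open[OF accessible_UNIV] by simp

lemma accessible_Times:
  assumes "accessible S" "accessible T"
  shows "accessible (S \<times> T)"
  using assms unfolding accessible_def Basis_prod_def by fastforce

lemma accessible_interval:
  assumes "interval_about_0 I"
  shows "accessible I"
  unfolding accessible_def
proof (intro ballI allI impI)
  fix x i e :: real
  assume x: "x \<in> I" and i: "i \<in> Basis" and e: "0 < e"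
  obtain c where c: "c \<in> I" "c \<noteq> x"
    using assms unfolding interval_about_0_def by blast
  \<comment> \<open>The step goes from \<open>x\<close> towards \<open>c\<close> and is no longer
    than their distance, so \<open>x + d\<close> lies between two points of
    \<open>I\<close>.\<close>
  define r where "r = min (e/2) \<bar>c - x\<bar>"
  define d where "d = (if c > x then r else - r)"
  have "0 < r" "r < e" "r \<le> \<bar>c - x\<bar>"
    using c e by (auto simp: r_def)
  moreover have "x + d \<in> I"
  proof -
    have "(x \<le> x + d \<and> x + d \<le> c) \<or> (c \<le> x + d \<and> x + d \<le> x)"
      using \<open>0 < r\<close> \<open>r \<le> \<bar>c - x\<bar>\<close> c by (auto simp: d_def)
    then show ?thesis
      using assms x c(1) unfolding interval_about_0_def is_interval_1 by blast
  qed
  ultimately show "\<exists>d. 0 < \<bar>d\<bar> \<and> \<bar>d\<bar> < e \<and> x + d *\<^sub>R i \<in> I"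
    using i by (intro exI[of _ d]) (auto simp: d_def)
qed

section \<open>Calculus of maps with finitely many derivatives\<close>

lemma frechet_derivative_cong_on:
  assumes "x \<in> S" "\<And>x. x \<in> S \<Longrightarrow> f x = g x"
  shows "frechet_derivative f (at x within S) = frechet_derivative g (at x within S)"
proof -
  have "(f has_derivative D) (at x within S) \<longleftrightarrow> (g has_derivative D) (at x within S)" for D
    using assms has_derivative_transform[of x S g f] has_derivative_transform[of x S f g] by metis
  then show ?thesis
    unfolding frechet_derivative_def by simp
qed

lemma Ck_on_cong:
  assumes "\<And>x. x \<in> S \<Longrightarrow> f x = g x" "Ck_on k S f"
  shows "Ck_on k S g"
  using assms
proof (induction k arbitrary: f g)
  case 0
  then show ?case using continuous_on_cong[of S S f g] by simp
next
  case (Suc k)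
  have "g differentiable_on S"
    using Suc.prems has_derivative_transform[of _ S g f]
    unfolding differentiable_on_def differentiable_def Ck_on.simps by metis
  moreover have "Ck_on k S (\<lambda>x. frechet_derivative g (at x within S) v)" for v
    using Suc.IH[of "\<lambda>x. frechet_derivative f (at x within S) v"] Suc.prems
      frechet_derivative_cong_on[of _ S f g] by (simp add: Ck_on.simps(2))
  ultimately show ?case by (simp add: Ck_on.simps(2))
qed

lemma Ck_on_SucI:
  assumes "accessible S" "\<And>x. x \<in> S \<Longrightarrow> (f has_derivative D x) (at x within S)"
    and "\<And>v. Ck_on k S (\<lambda>x. D x v)"
  shows "Ck_on (Suc k) S f"
  unfolding Ck_on.simps differentiable_on_def differentiable_def
proof (intro conjI ballI allI)
  show "Ck_on k S (\<lambda>x. frechet_derivative f (at x within S) v)" for v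
    by (rule Ck_on_cong[OF _ assms(3)[of v]])
      (simp add: accessible_frechet_derivative[OF assms(1) _ assms(2)])
qed (use assms(2) in blast)

lemma Ck_on_SucD:
  assumes "Ck_on (Suc k) S f"
  shows "x \<in> S \<Longrightarrow> (f has_derivative frechet_derivative f (at x within S)) (at x within S)"
    and "Ck_on k S (\<lambda>x. frechet_derivative f (at x within S) v)"
  using assms frechet_derivative_works by (auto simp: differentiable_on_def Ck_on.simps(2))

lemma Ck_on_continuous: "Ck_on k S f \<Longrightarrow> continuous_on S f"
  by (cases k) (auto simp: Ck_on.simps(2) intro: differentiable_imp_continuous_on)

lemma Ck_on_SucD_less: "Ck_on (Suc k) S f \<Longrightarrow> Ck_on k S f"
proof (induction k arbitrary: f)
  case 0
  then show ?case using Ck_on_continuous by (metis Ck_on.simps(1))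
qed (simp add: Ck_on.simps(2))

lemma at_within_Int_open: "\<lbrakk>open N; x \<in> N\<rbrakk> \<Longrightarrow> at x within (S \<inter> N) = at x within S"
  by (rule at_within_nhd[of x N]) auto

text \<open>Intersecting \<open>S\<close> with an open set leaves the filter
  \<open>at x within S\<close> unchanged at points of that set, so local and global derivatives
  agree. This allows maps into the manifold to be treated one chart at a time.\<close>

lemma Ck_on_local:
  assumes "\<And>x. x \<in> S \<Longrightarrow> \<exists>N. open N \<and> x \<in> N \<and> Ck_on k (S \<inter> N) f"
  shows "Ck_on k S f"
  using assms
proof (induction k arbitrary: f)
  case 0
  then show ?case
    unfolding Ck_on.simps continuous_on_eq_continuous_within
    by (metis IntI at_within_Int_open continuous_within)
next
  case (Suc k)
  have eq: "at x within (S \<inter> N) = at x within S" if "open N" "x \<in> N" for x and N :: "'a set"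
    using that by (metis at_within_Int_open)
  have "f differentiable_on S"
    unfolding differentiable_on_def
  proof
    fix x assume "x \<in> S"
    then show "f differentiable at x within S"
      using Suc.prems[of x] eq unfolding Ck_on.simps differentiable_on_def by (metis IntI)
  qed
  moreover have "Ck_on k S (\<lambda>x. frechet_derivative f (at x within S) v)" for v
  proof (rule Suc.IH)
    fix x assume "x \<in> S"
    then obtain N where N: "open N" "x \<in> N" "Ck_on (Suc k) (S \<inter> N) f"
      using Suc.prems by blast
    have "Ck_on k (S \<inter> N) (\<lambda>x. frechet_derivative f (at x within (S \<inter> N)) v)"
      using N by (simp add: Ck_on.simps(2))
    then have "Ck_on k (S \<inter> N) (\<lambda>x. frechet_derivative f (at x within S) v)"
      by (rule Ck_on_cong[rotated]) (use N eq in auto)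
    then show "\<exists>N. open N \<and> x \<in> N \<and> Ck_on k (S \<inter> N) (\<lambda>x. frechet_derivative f (at x within S) v)"
      using N by blast
  qed
  ultimately show ?case by (simp add: Ck_on.simps(2))
qed

lemma Ck_on_Int_open:
  assumes "Ck_on k S f" "open N"
  shows "Ck_on k (S \<inter> N) f"
  using assms(1)
proof (induction k arbitrary: f)
  case 0
  then show ?case using continuous_on_subset by fastforce
next
  case (Suc k)
  have eq: "at x within (S \<inter> N) = at x within S" if "x \<in> N" for x
    using that assms by (metis at_within_Int_open)
  have "f differentiable_on (S \<inter> N)"
    using Suc.prems differentiable_on_subset[of f S "S \<inter> N"] by (auto simp: Ck_on.simps(2))
  moreover have "Ck_on k (S \<inter> N) (\<lambda>x. frechet_derivative f (at x within (S \<inter> N)) v)" for v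
    by (rule Ck_on_cong[of _ "\<lambda>x. frechet_derivative f (at x within S) v"])
      (use eq Suc in \<open>auto simp: Ck_on.simps(2)\<close>)
  ultimately show ?case by (simp add: Ck_on.simps(2))
qed

lemma Ck_on_const: "accessible S \<Longrightarrow> Ck_on k S (\<lambda>x. c)"
proof (induction k arbitrary: c)
  case (Suc k)
  then show ?case by (intro Ck_on_SucI[where D = "\<lambda>x v. 0"]) auto
qed auto

lemma Ck_on_bounded_linear:
  assumes "accessible S" "bounded_linear h" "Ck_on k S f"
  shows "Ck_on k S (\<lambda>x. h (f x))"
  using assms(3)
proof (induction k arbitrary: f)
  case 0
  then show ?case using bounded_linear.continuous_on[OF assms(2)] by simp
next
  case (Suc k)
  show ?case
    by (rule Ck_on_SucI[where D = "\<lambda>x v. h (frechet_derivative f (at x within S) v)"])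
      (auto intro!: assms Suc.IH bounded_linear.has_derivative[OF assms(2)] Ck_on_SucD[OF Suc.prems])
qed

lemma Ck_on_id: "accessible S \<Longrightarrow> Ck_on k S (\<lambda>x. x)"
  by (cases k) (auto intro: Ck_on_SucI[where D = "\<lambda>x v. v"] Ck_on_const)

lemma Ck_on_add:
  assumes "accessible S" "Ck_on k S f" "Ck_on k S g"
  shows "Ck_on k S (\<lambda>x. f x + g x)"
  using assms(2,3)
proof (induction k arbitrary: f g)
  case 0
  then show ?case by (simp add: continuous_on_add)
next
  case (Suc k)
  show ?case
    by (rule Ck_on_SucI[where D = "\<lambda>x v. frechet_derivative f (at x within S) v
          + frechet_derivative g (at x within S) v"])
      (auto intro!: assms Suc.IH has_derivative_add Ck_on_SucD[OF Suc.prems(1)]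
        Ck_on_SucD[OF Suc.prems(2)])
qed

lemma Ck_on_sum:
  assumes "accessible S" "\<And>i. i \<in> B \<Longrightarrow> Ck_on k S (f i)"
  shows "Ck_on k S (\<lambda>x. \<Sum>i\<in>B. f i x)"
  using assms(2)
  by (induction B rule: infinite_finite_induct) (auto intro: Ck_on_add Ck_on_const assms(1))

lemma Ck_on_scaleR:
  fixes f :: "'a::euclidean_space \<Rightarrow> real"
  assumes "accessible S" "Ck_on k S f" "Ck_on k S g"
  shows "Ck_on k S (\<lambda>x. f x *\<^sub>R g x)"
  using assms(2,3)
proof (induction k arbitrary: f g)
  case 0
  then show ?case by (simp add: continuous_on_scaleR)
next
  case (Suc k)
  have "Ck_on k S (\<lambda>x. f x *\<^sub>R frechet_derivative g (at x within S) v
          + frechet_derivative f (at x within S) v *\<^sub>R g x)" for v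
    using Suc.prems by (intro Ck_on_add assms Suc.IH Ck_on_SucD(2)) (auto intro: Ck_on_SucD_less)
  then show ?case
    by (rule Ck_on_SucI[where D = "\<lambda>x v. f x *\<^sub>R frechet_derivative g (at x within S) v
          + frechet_derivative f (at x within S) v *\<^sub>R g x", rotated 2])
      (auto intro!: assms has_derivative_scaleR Ck_on_SucD(1)[OF Suc.prems(1)]
        Ck_on_SucD(1)[OF Suc.prems(2)])
qed

text \<open>The pair is \<open>(f x, 0) + (0, g x)\<close>, a sum of two bounded linear
  images.\<close>

lemma Ck_on_Pair:
  assumes "accessible S" "Ck_on k S f" "Ck_on k S g"
  shows "Ck_on k S (\<lambda>x. (f x, g x))"
proof -
  have 1: "bounded_linear (\<lambda>a. (a, 0))"
    by (intro bounded_linear_Pair bounded_linear_ident bounded_linear_zero)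
  have 2: "bounded_linear (\<lambda>b. (0, b))"
    by (intro bounded_linear_Pair bounded_linear_ident bounded_linear_zero)
  show ?thesis
    using Ck_on_add[OF assms(1) Ck_on_bounded_linear[OF assms(1) 1 assms(2)]
        Ck_on_bounded_linear[OF assms(1) 2 assms(3)]]
    by simp
qed

lemma linear_eq_sum_Basis:
  fixes L :: "'a::euclidean_space \<Rightarrow> 'b::real_vector"
  assumes "linear L"
  shows "L v = (\<Sum>b\<in>Basis. (v \<bullet> b) *\<^sub>R L b)"
proof -
  have "L v = L (\<Sum>b\<in>Basis. (v \<bullet> b) *\<^sub>R b)"
    by (simp add: euclidean_representation)
  also have "\<dots> = (\<Sum>b\<in>Basis. (v \<bullet> b) *\<^sub>R L b)"
    using assms by (simp add: linear_sum linear_scale)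
  finally show ?thesis .
qed

lemma Ck_on_compose:
  fixes f :: "'a::euclidean_space \<Rightarrow> 'b::euclidean_space"
  assumes "accessible S" "Ck_on k S f" "Ck_on k T g" "f ` S \<subseteq> T"
  shows "Ck_on k S (\<lambda>x. g (f x))"
  using assms(2,3)
proof (induction k arbitrary: g)
  case 0
  then show ?case using assms(4) by (auto intro: continuous_on_compose2)
next
  case (Suc k)
  let ?f' = "\<lambda>x. frechet_derivative f (at x within S)"
  let ?g' = "\<lambda>y. frechet_derivative g (at y within T)"
  have D: "((\<lambda>x. g (f x)) has_derivative (\<lambda>v. ?g' (f x) (?f' x v))) (at x within S)"
    if "x \<in> S" for x
  proof (rule has_derivative_in_compose2[OF _ assms(4) that])
    show "(g has_derivative ?g' y) (at y within T)" if "y \<in> T" for y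
      by (rule Ck_on_SucD(1)[OF Suc.prems(2) that])
    show "(f has_derivative ?f' x) (at x within S)"
      by (rule Ck_on_SucD(1)[OF Suc.prems(1) that])
  qed
  have "Ck_on k S (\<lambda>x. ?g' (f x) (?f' x v))" for v
  proof (rule Ck_on_cong)
    \<comment> \<open>\<open>Ck_on\<close> controls the derivative of \<open>g\<close> in fixed
      directions, while the chain rule produces the direction \<open>?f' x v\<close>, which varies
      with \<open>x\<close>. Expanding it in the basis turns the derivative into a sum of products
      of known functions.\<close>
    show "Ck_on k S (\<lambda>x. \<Sum>b\<in>Basis. (?f' x v \<bullet> b) *\<^sub>R ?g' (f x) b)"
    proof (intro Ck_on_sum Ck_on_scaleR assms(1))
      fix b :: 'b assume "b \<in> Basis"
      show "Ck_on k S (\<lambda>x. ?f' x v \<bullet> b)"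
        by (rule Ck_on_bounded_linear[OF assms(1) bounded_linear_inner_left Ck_on_SucD(2)[OF Suc.prems(1)]])
      show "Ck_on k S (\<lambda>x. ?g' (f x) b)"
        by (rule Suc.IH[OF Ck_on_SucD_less[OF Suc.prems(1)] Ck_on_SucD(2)[OF Suc.prems(2)]])
    qed
    fix x assume "x \<in> S"
    then have "f x \<in> T" using assms(4) by blast
    then have "linear (?g' (f x))"
      by (rule has_derivative_linear[OF Ck_on_SucD(1)[OF Suc.prems(2)]])
    then show "(\<Sum>b\<in>Basis. (?f' x v \<bullet> b) *\<^sub>R ?g' (f x) b) = ?g' (f x) (?f' x v)"
      by (simp add: linear_eq_sum_Basis[of "?g' (f x)" "?f' x v"])
  qed
  from Ck_on_SucI[OF assms(1) D this] show ?case
    by simp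
qed

lemma smooth_onI: "(\<And>k. Ck_on k S f) \<Longrightarrow> smooth_on S f"
  and smooth_onD: "smooth_on S f \<Longrightarrow> Ck_on k S f"
  by (auto simp: smooth_on_def)

lemma smooth_on_cong:
  "\<lbrakk>\<And>x. x \<in> S \<Longrightarrow> f x = g x; smooth_on S f\<rbrakk> \<Longrightarrow> smooth_on S g"
  by (rule smooth_onI, rule Ck_on_cong[OF _ smooth_onD])

lemma smooth_on_local:
  assumes "\<And>x. x \<in> S \<Longrightarrow> \<exists>N. open N \<and> x \<in> N \<and> smooth_on (S \<inter> N) f"
  shows "smooth_on S f"
proof (rule smooth_onI)
  fix k
  show "Ck_on k S f"
  proof (rule Ck_on_local)
    fix x assume "x \<in> S"
    then obtain N where "open N" "x \<in> N" "smooth_on (S \<inter> N) f"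
      using assms by blast
    then show "\<exists>N. open N \<and> x \<in> N \<and> Ck_on k (S \<inter> N) f"
      by (intro exI[of _ N]) (simp add: smooth_onD)
  qed
qed

lemma smooth_on_continuous: "smooth_on S f \<Longrightarrow> continuous_on S f"
  using smooth_onD[of S f 0] by simp

lemma smooth_on_Int_open: "\<lbrakk>smooth_on S f; open N\<rbrakk> \<Longrightarrow> smooth_on (S \<inter> N) f"
  by (simp add: smooth_on_def Ck_on_Int_open)

lemma smooth_on_const: "accessible S \<Longrightarrow> smooth_on S (\<lambda>x. c)"
  by (simp add: smooth_on_def Ck_on_const)

lemma smooth_on_bounded_linear:
  "\<lbrakk>accessible S; bounded_linear h\<rbrakk> \<Longrightarrow> smooth_on S h"
  using Ck_on_bounded_linear[OF _ _ Ck_on_id] by (auto simp: smooth_on_def)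

lemma smooth_on_add:
  "\<lbrakk>accessible S; smooth_on S f; smooth_on S g\<rbrakk> \<Longrightarrow> smooth_on S (\<lambda>x. f x + g x)"
  by (simp add: smooth_on_def Ck_on_add)

lemma smooth_on_scaleR:
  fixes f :: "'a::euclidean_space \<Rightarrow> real"
  shows "\<lbrakk>accessible S; smooth_on S f; smooth_on S g\<rbrakk> \<Longrightarrow> smooth_on S (\<lambda>x. f x *\<^sub>R g x)"
  by (simp add: smooth_on_def Ck_on_scaleR)

lemma smooth_on_mult:
  fixes f g :: "'a::euclidean_space \<Rightarrow> real"
  shows "\<lbrakk>accessible S; smooth_on S f; smooth_on S g\<rbrakk> \<Longrightarrow> smooth_on S (\<lambda>x. f x * g x)"
  using smooth_on_scaleR[of S f g] by simp

lemma smooth_on_Pair: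
  "\<lbrakk>accessible S; smooth_on S f; smooth_on S g\<rbrakk> \<Longrightarrow> smooth_on S (\<lambda>x. (f x, g x))"
  by (simp add: smooth_on_def Ck_on_Pair)

lemma smooth_on_compose:
  fixes f :: "'a::euclidean_space \<Rightarrow> 'b::euclidean_space"
  shows "\<lbrakk>accessible S; smooth_on S f; smooth_on T g; f ` S \<subseteq> T\<rbrakk> \<Longrightarrow> smooth_on S (\<lambda>x. g (f x))"
  by (rule smooth_onI, rule Ck_on_compose[OF _ smooth_onD smooth_onD])

lemma smooth_on_has_derivative:
  "\<lbrakk>smooth_on S f; x \<in> S\<rbrakk> \<Longrightarrow>
     (f has_derivative frechet_derivative f (at x within S)) (at x within S)"
  by (rule Ck_on_SucD(1)[OF smooth_onD])

lemma smooth_on_frechet_derivative: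
  "smooth_on S f \<Longrightarrow> smooth_on S (\<lambda>x. frechet_derivative f (at x within S) v)"
  by (rule smooth_onI, rule Ck_on_SucD(2)[OF smooth_onD])

lemma smooth_on_fst: "accessible S \<Longrightarrow> smooth_on S fst"
  and smooth_on_snd: "accessible S \<Longrightarrow> smooth_on S snd"
  by (auto intro: smooth_on_bounded_linear bounded_linear_fst bounded_linear_snd)

subsection \<open>Inverse maps\<close>

text \<open>Where the scalar factor vanishes, the product rule asks only for convergence of the
  other factor. This permits differentiating an inverse that is so far known only to be
  continuous.\<close>

lemma has_derivative_scaleR_vanishing:
  fixes a :: "'a::real_normed_vector \<Rightarrow> real"
  assumes "(a has_derivative a') (at x within S)" "a x = 0" "(k \<longlongrightarrow> k x) (at x within S)"
  shows "((\<lambda>y. a y *\<^sub>R k y) has_derivative (\<lambda>h. a' h *\<^sub>R k x)) (at x within S)"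
proof -
  interpret a': bounded_linear a' using assms(1) by (rule has_derivative_bounded_linear)
  obtain B where B: "\<And>h. norm (a' h) \<le> norm h * B"
    using a'.bounded by blast
  have "((\<lambda>y. (a y - a x - a' (y - x)) /\<^sub>R norm (y - x)) \<longlongrightarrow> 0) (at x within S)"
    using assms(1) by (simp add: has_derivative_at_within)
  then have 1: "((\<lambda>y. ((a y - a x - a' (y - x)) /\<^sub>R norm (y - x)) *\<^sub>R k y) \<longlongrightarrow> 0) (at x within S)"
    using tendsto_scaleR[OF _ assms(3), of _ 0] by simp
  have 2: "((\<lambda>y. (a' (y - x) / norm (y - x)) *\<^sub>R (k y - k x)) \<longlongrightarrow> 0) (at x within S)"
  proof (rule Lim_null_comparison)
    show "((\<lambda>y. \<bar>B\<bar> * norm (k y - k x)) \<longlongrightarrow> 0) (at x within S)"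
      by (rule tendsto_eq_intros assms(3) refl)+ simp
    have "norm ((a' (y - x) / norm (y - x)) *\<^sub>R (k y - k x)) \<le> \<bar>B\<bar> * norm (k y - k x)" for y
    proof -
      have "\<bar>a' (y - x)\<bar> \<le> norm (y - x) * \<bar>B\<bar>"
        using B[of "y - x"] by (metis abs_ge_self mult_left_mono norm_ge_zero order_trans real_norm_def)
      then have "\<bar>a' (y - x) / norm (y - x)\<bar> \<le> \<bar>B\<bar>"
        by (cases "y = x") (auto simp: field_simps)
      then show ?thesis
        unfolding norm_scaleR by (intro mult_right_mono) auto
    qed
    then show "\<forall>\<^sub>F y in at x within S.
        norm ((a' (y - x) / norm (y - x)) *\<^sub>R (k y - k x)) \<le> \<bar>B\<bar> * norm (k y - k x)"
      by (intro always_eventually allI)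
  qed
  \<comment> \<open>The remainder of the product is the remainder of \<open>a\<close> times
    \<open>k\<close>, null by differentiability, plus a bounded quotient times
    \<open>k y - k x\<close>, null by convergence.\<close>
  have eq: "((a y - a x - a' (y - x)) /\<^sub>R norm (y - x)) *\<^sub>R k y
      + (a' (y - x) / norm (y - x)) *\<^sub>R (k y - k x)
      = (a y *\<^sub>R k y - a x *\<^sub>R k x - a' (y - x) *\<^sub>R k x) /\<^sub>R norm (y - x)" for y
    by (simp add: assms(2) algebra_simps divide_inverse flip: scaleR_add_left)
  have "bounded_linear (\<lambda>h. a' h *\<^sub>R k x)"
    by (rule bounded_linear_compose[OF bounded_linear_scaleR_left a'.bounded_linear_axioms])
  then show ?thesis
    using tendsto_add[OF 1 2] unfolding has_derivative_at_within eq by simp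
qed

text \<open>Inverse matrices depend smoothly on the matrix. Continuity comes from a lower bound for
  \<open>L x0\<close>; then the derivative is \<open>- K L' K\<close>, and since this formula
  contains \<open>K\<close> itself, each order of smoothness yields the next.\<close>

lemma Ck_on_inverse_family:
  fixes L K :: "'a::euclidean_space \<Rightarrow> 'b::euclidean_space \<Rightarrow> 'b"
  assumes "accessible S" and L: "\<And>b. smooth_on S (\<lambda>x. L x b)"
    and lin: "\<And>x. x \<in> S \<Longrightarrow> linear (L x)" "\<And>x. x \<in> S \<Longrightarrow> linear (K x)"
    and KL: "\<And>x v. x \<in> S \<Longrightarrow> K x (L x v) = v"
    and LK: "\<And>x v. x \<in> S \<Longrightarrow> L x (K x v) = v"
  shows "Ck_on k S (\<lambda>x. K x v)"
proof -
  have Lcont: "continuous_on S (\<lambda>x. L x b)" for b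
    using L smooth_on_continuous by blast
  have Kcont: "((\<lambda>x. K x v) \<longlongrightarrow> K x0 v) (at x0 within S)" if x0: "x0 \<in> S" for x0 v
  proof -
    have Ltend: "((\<lambda>x. L x b) \<longlongrightarrow> L x0 b) (at x0 within S)" for b
      using Lcont x0 by (auto simp: continuous_on_def)
    \<comment> \<open>An injective linear map in finite dimension is bounded below. Near
      \<open>x0\<close> the map \<open>L x\<close> loses at most half of this bound.\<close>
    obtain c where c: "c > 0" "\<And>w. c * norm w \<le> norm (L x0 w)"
      using linear_inj_bounded_below_pos[of "L x0"] lin(1)[OF x0] KL[OF x0]
      by (metis injI)
    define m where "m = (\<lambda>x. \<Sum>b\<in>Basis. norm (L x b - L x0 b))"
    have diff: "norm (L x w - L x0 w) \<le> m x * norm w" if "x \<in> S" for x w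
    proof -
      have "L x w - L x0 w = (\<Sum>b\<in>Basis. (w \<bullet> b) *\<^sub>R (L x b - L x0 b))"
        by (simp add: linear_eq_sum_Basis[OF lin(1)[OF that], of w]
            linear_eq_sum_Basis[OF lin(1)[OF x0], of w] scaleR_diff_right sum_subtractf)
      also have "norm \<dots> \<le> (\<Sum>b\<in>Basis. norm ((w \<bullet> b) *\<^sub>R (L x b - L x0 b)))"
        by (rule norm_sum)
      also have "\<dots> \<le> (\<Sum>b\<in>Basis. norm w * norm (L x b - L x0 b))"
        by (intro sum_mono) (auto intro!: mult_right_mono Basis_le_norm)
      finally show ?thesis
        by (simp add: m_def sum_distrib_left mult.commute)
    qed
    have "(m \<longlongrightarrow> 0) (at x0 within S)"
      unfolding m_def by (rule tendsto_eq_intros Ltend refl)+ simp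
    then have small: "\<forall>\<^sub>F x in at x0 within S. m x < c / 2"
      using c order_tendstoD(2)[of m 0 _ "c/2"] by auto
    have lim0: "((\<lambda>x. 2 / c * norm (L x (K x0 v) - L x0 (K x0 v))) \<longlongrightarrow> 0) (at x0 within S)"
      by (rule tendsto_eq_intros Ltend refl)+ simp
    have eventually_mem: "\<forall>\<^sub>F x in at x0 within S. x \<in> S"
      by (simp add: eventually_at_filter)
    have "\<forall>\<^sub>F x in at x0 within S.
        norm (K x v - K x0 v) \<le> 2 / c * norm (L x (K x0 v) - L x0 (K x0 v))"
      using small eventually_mem
    proof (rule eventually_elim2)
      fix x assume x: "m x < c / 2" "x \<in> S"
      define u where "u = K x v - K x0 v"
      \<comment> \<open>Both \<open>L x (K x v)\<close> and \<open>L x0 (K x0 v)\<close> equal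
        \<open>v\<close>. This expresses \<open>L x u\<close> through the continuous function
        \<open>\<lambda>x. L x (K x0 v)\<close> instead of the unknown \<open>K x\<close>.\<close>
      have Lu: "L x u = - (L x (K x0 v) - L x0 (K x0 v))"
        using LK[OF x(2), of v] LK[OF x0, of v] linear_diff[OF lin(1)[OF x(2)]] by (simp add: u_def)
      have "c * norm u \<le> norm (L x0 u)" by (rule c)
      also have "\<dots> \<le> norm (L x u) + norm (L x u - L x0 u)"
        by (metis norm_triangle_sub norm_minus_commute)
      also have "\<dots> \<le> norm (L x u) + c / 2 * norm u"
        using diff[OF x(2), of u] x(1) mult_right_mono[of "m x" "c/2" "norm u"] by auto
      finally have "c / 2 * norm u \<le> norm (L x u)" by (simp add: algebra_simps)
      then show "norm (K x v - K x0 v) \<le> 2 / c * norm (L x (K x0 v) - L x0 (K x0 v))"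
        using c(1) unfolding Lu norm_minus_cancel by (simp add: u_def field_simps)
    qed
    then have "((\<lambda>x. K x v - K x0 v) \<longlongrightarrow> 0) (at x0 within S)"
      by (rule Lim_null_comparison[OF _ lim0])
    then show ?thesis by (simp add: LIM_zero_iff)
  qed
  have Kcont_on: "continuous_on S (\<lambda>x. K x v)" for v
    using Kcont by (auto simp: continuous_on_def)
  let ?L' = "\<lambda>x b. frechet_derivative (\<lambda>x. L x b) (at x within S)"
  have Kder: "((\<lambda>x. K x v) has_derivative (\<lambda>h. - K x0 (?L' x0 (K x0 v) h))) (at x0 within S)"
    if x0: "x0 \<in> S" for x0 v
  proof -
    define w where "w = K x0 v"
    have dL: "((\<lambda>x. L x w) has_derivative ?L' x0 w) (at x0 within S)"
      using smooth_on_has_derivative[OF L x0] .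
    \<comment> \<open>The identity \<open>K x v = w - K x (L x w - L x0 w)\<close>, written in
      coordinates: the scalar factors vanish at \<open>x0\<close>, so
      \<open>has_derivative_scaleR_vanishing\<close> applies although \<open>K\<close> is merely
      continuous so far.\<close>
    have sum: "K x0 v + (\<Sum>b\<in>Basis. (- ((L x w - L x0 w) \<bullet> b)) *\<^sub>R K x b) = K x v" if x: "x \<in> S" for x
    proof -
      have "(\<Sum>b\<in>Basis. (- ((L x w - L x0 w) \<bullet> b)) *\<^sub>R K x b) = - K x (L x w - L x0 w)"
        by (simp add: linear_eq_sum_Basis[OF lin(2)[OF x], of "L x w - L x0 w"] sum_negf)
      also have "\<dots> = - w + K x v"
        using KL[OF x] LK[OF x0] linear_diff[OF lin(2)[OF x]] by (simp add: w_def)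
      finally show ?thesis by (simp add: w_def)
    qed
    have "((\<lambda>x. K x0 v + (\<Sum>b\<in>Basis. (- ((L x w - L x0 w) \<bullet> b)) *\<^sub>R K x b)) has_derivative
        (\<lambda>h. 0 + (\<Sum>b\<in>Basis. (- ((?L' x0 w h - 0) \<bullet> b)) *\<^sub>R K x0 b))) (at x0 within S)"
      by (intro has_derivative_add has_derivative_sum has_derivative_scaleR_vanishing
          has_derivative_minus has_derivative_inner_left has_derivative_diff dL has_derivative_const Kcont x0) simp
    moreover have "0 + (\<Sum>b\<in>Basis. (- ((?L' x0 w h - 0) \<bullet> b)) *\<^sub>R K x0 b) = - K x0 (?L' x0 w h)" for h
      by (simp add: linear_eq_sum_Basis[OF lin(2)[OF x0], of "?L' x0 w h"] sum_negf)
    ultimately have "((\<lambda>x. K x0 v + (\<Sum>b\<in>Basis. (- ((L x w - L x0 w) \<bullet> b)) *\<^sub>R K x b)) has_derivative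
        (\<lambda>h. - K x0 (?L' x0 w h))) (at x0 within S)"
      by simp
    then show ?thesis
      unfolding w_def[symmetric] by (rule has_derivative_transform[OF x0, rotated]) (rule sum[folded w_def, symmetric])
  qed
  show ?thesis
  proof (induction k arbitrary: v)
    case 0
    then show ?case using Kcont_on by simp
  next
    case (Suc k)
    have "Ck_on k S (\<lambda>x. - K x (?L' x (K x v) h))" for h
    proof (rule Ck_on_cong)
      \<comment> \<open>Both the argument \<open>K x v\<close> of \<open>L'\<close> and the argument
        of the outer \<open>K x\<close> vary with \<open>x\<close>. Expanding each in the basis
        leaves products of functions covered by the induction hypothesis and by smoothness of
        \<open>L\<close>.\<close>
      show "Ck_on k S (\<lambda>x. \<Sum>c\<in>Basis. (\<Sum>b\<in>Basis. (K x v \<bullet> b) *\<^sub>R (?L' x b h \<bullet> c)) *\<^sub>R (- K x c))"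
        by (intro Ck_on_sum Ck_on_scaleR assms(1) Suc
            Ck_on_bounded_linear[OF assms(1) bounded_linear_inner_left]
            Ck_on_bounded_linear[OF assms(1) bounded_linear_minus[OF bounded_linear_ident]]
            smooth_onD[OF smooth_on_frechet_derivative[OF L]])
    next
      fix x assume x: "x \<in> S"
      define w where "w = K x v"
      have "((\<lambda>x. \<Sum>b\<in>Basis. (w \<bullet> b) *\<^sub>R L x b) has_derivative (\<lambda>h. \<Sum>b\<in>Basis. (w \<bullet> b) *\<^sub>R ?L' x b h))
          (at x within S)"
        by (intro has_derivative_sum has_derivative_scaleR_right smooth_on_has_derivative[OF L x])
      then have "((\<lambda>x. L x w) has_derivative (\<lambda>h. \<Sum>b\<in>Basis. (w \<bullet> b) *\<^sub>R ?L' x b h)) (at x within S)"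
        by (rule has_derivative_transform[OF x, rotated]) (use linear_eq_sum_Basis[OF lin(1)] in blast)
      then have "?L' x w = (\<lambda>h. \<Sum>b\<in>Basis. (w \<bullet> b) *\<^sub>R ?L' x b h)"
        by (rule accessible_frechet_derivative[OF assms(1) x])
      then have "?L' x w h \<bullet> c = (\<Sum>b\<in>Basis. (w \<bullet> b) *\<^sub>R (?L' x b h \<bullet> c))" for c
        by (simp add: inner_sum_left)
      then show "(\<Sum>c\<in>Basis. (\<Sum>b\<in>Basis. (K x v \<bullet> b) *\<^sub>R (?L' x b h \<bullet> c)) *\<^sub>R (- K x c)) = - K x (?L' x (K x v) h)"
        by (simp add: linear_eq_sum_Basis[OF lin(2)[OF x], of "?L' x w h"] sum_negf flip: w_def)
    qed
    from Ck_on_SucI[OF assms(1) Kder this] show ?case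
      by simp
  qed
qed

text \<open>The inverse \<open>G\<close> is given and continuous, so it remains to differentiate it.
  Its derivative at \<open>s\<close> is \<open>K (G s)\<close>, the inverse of the derivative of
  \<open>F\<close> at \<open>G s\<close>; if \<open>G\<close> is of class k, so is this derivative,
  and \<open>G\<close> is of class k + 1.\<close>

theorem smooth_on_inverse:
  fixes F G :: "'a::euclidean_space \<Rightarrow> 'a"
  assumes "accessible S" "accessible T" and F: "smooth_on T F" and ST: "F ` T = S"
    and G: "continuous_on S G" and GF: "\<And>x. x \<in> T \<Longrightarrow> G (F x) = x"
    and inj: "\<And>x v. \<lbrakk>x \<in> T; frechet_derivative F (at x within T) v = 0\<rbrakk> \<Longrightarrow> v = 0"
  shows "smooth_on S G"
proof (rule smooth_onI)
  let ?F' = "\<lambda>x. frechet_derivative F (at x within T)"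
  define K where "K = (\<lambda>x. inv_into UNIV (?F' x))"
  have lin: "linear (?F' x)" if "x \<in> T" for x
    using has_derivative_linear smooth_on_has_derivative[OF F that] by blast
  have injF: "inj (?F' x)" if "x \<in> T" for x
    using inj[OF that] linear_injective_0[OF lin[OF that]] by blast
  have KF: "K x (?F' x v) = v" if "x \<in> T" for x v
    using injF[OF that] by (simp add: K_def)
  have FK: "?F' x (K x v) = v" if "x \<in> T" for x v
    using linear_injective_imp_surjective[OF lin[OF that] injF[OF that]]
    by (simp add: K_def surj_f_inv_f)
  have linK: "linear (K x)" if "x \<in> T" for x
  proof (rule linearI)
    show "K x (a + b) = K x a + K x b" for a b
      using KF[OF that, of "K x a + K x b"] FK[OF that] linear_add[OF lin[OF that]] by simp
    show "K x (c *\<^sub>R b) = c *\<^sub>R K x b" for c b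
      using KF[OF that, of "c *\<^sub>R K x b"] FK[OF that] linear_scale[OF lin[OF that]] by simp
  qed
  have K: "Ck_on k T (\<lambda>x. K x v)" for k v
    by (rule Ck_on_inverse_family[where L = ?F']) (use assms lin linK KF FK smooth_on_frechet_derivative in auto)
  have GT: "G ` S \<subseteq> T"
    using GF ST by auto
  have FG: "F (G s) = s" if "s \<in> S" for s
    using that GF ST by auto
  have der: "(G has_derivative K (G s)) (at s within S)" if "s \<in> S" for s
  proof -
    have Gs: "G s \<in> T" using that GT by blast
    have "continuous (at s within S) G"
      using G that continuous_on_eq_continuous_within by blast
    then have "(G has_derivative K (G s)) (at (F (G s)) within F ` T)"
      using Gs KF[OF Gs] that
      by (intro has_derivative_inverse_within[OF smooth_on_has_derivative[OF F Gs]])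
        (auto simp: ST FG GF linK intro!: ext)
    then show ?thesis using FG[OF that] ST by simp
  qed
  show "Ck_on k S G" for k
  proof (induction k)
    case 0
    then show ?case using G by simp
  next
    case (Suc k)
    from Ck_on_SucI[OF assms(1) der Ck_on_compose[OF assms(1) Suc K GT]] show ?case
      by simp
  qed
qed

section \<open>Smooth maps into the manifold\<close>

text \<open>Curves in the manifold and families read off in a chart, with variables
  \<open>(t, z)\<close>, are both maps of this kind, so composition with a family is proved once for
  both.\<close>

definition mfd_smooth_on ::
    "('m::topological_space, 'e::euclidean_space) chart set \<Rightarrow> 'a::euclidean_space set \<Rightarrow> ('a \<Rightarrow> 'm) \<Rightarrow> bool"
  where
  "mfd_smooth_on A S \<Phi> \<longleftrightarrow> continuous_on S \<Phi> \<and>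
     (\<forall>(V, y)\<in>A. smooth_on {s\<in>S. \<Phi> s \<in> V} (\<lambda>s. y (\<Phi> s)))"

text \<open>The smoothness half of \<open>smooth_diff_curve\<close>, without membership in the
  diffeomorphism group, so that composites can be treated before the group enters.\<close>

definition smooth_family ::
    "('m::topological_space, 'e::euclidean_space) chart set \<Rightarrow> real set \<Rightarrow> (real \<Rightarrow> 'm \<Rightarrow> 'm) \<Rightarrow> bool"
  where
  "smooth_family A I \<phi> \<longleftrightarrow> continuous_on (I \<times> UNIV) (\<lambda>(t, p). \<phi> t p) \<and>
     (\<forall>(U, x)\<in>A. mfd_smooth_on A (I \<times> x ` U) (\<lambda>(t, z). \<phi> t (inv_into U x z)))"

text \<open>Smooth functions on the product of the time interval and the manifold. Pullbacks of
  smooth functions along a family are of this kind, and so are their time derivatives; Taylor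
  expansion takes place here.\<close>

definition smooth_time_function ::
    "('m::topological_space, 'e::euclidean_space) chart set \<Rightarrow> real set \<Rightarrow> (real \<Rightarrow> 'm \<Rightarrow> real) \<Rightarrow> bool"
  where
  "smooth_time_function A I F \<longleftrightarrow>
     (\<forall>(U, x)\<in>A. smooth_on (I \<times> x ` U) (\<lambda>(t, z). F t (inv_into U x z)))"

lemma mfd_smooth_onI:
  assumes "continuous_on S \<Phi>"
    and "\<And>V y. (V, y) \<in> A \<Longrightarrow> smooth_on {s\<in>S. \<Phi> s \<in> V} (\<lambda>s. y (\<Phi> s))"
  shows "mfd_smooth_on A S \<Phi>"
  using assms by (auto simp: mfd_smooth_on_def)

lemma mfd_smooth_onD:
  assumes "mfd_smooth_on A S \<Phi>"
  shows "continuous_on S \<Phi>"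
    and "(V, y) \<in> A \<Longrightarrow> smooth_on {s\<in>S. \<Phi> s \<in> V} (\<lambda>s. y (\<Phi> s))"
  using assms by (auto simp: mfd_smooth_on_def)

lemma preimage_relatively_open:
  assumes "continuous_on S \<Phi>" "open V"
  obtains N where "open N" "{s\<in>S. \<Phi> s \<in> V} = S \<inter> N"
proof -
  obtain N where "open N" "N \<inter> S = \<Phi> -` V \<inter> S"
    using assms continuous_on_open_invariant by metis
  then show ?thesis by (intro that[of N]) auto
qed

section \<open>Charts, and composition and inversion of smooth families\<close>

locale smooth_manifold =
  fixes A :: "('m::t2_space, 'e::euclidean_space) chart set"
  assumes atlas: "smooth_atlas A"
begin

lemma chart_homeomorphism:
  assumes "(U, x) \<in> A"
  shows "open U" "open (x ` U)" "continuous_on U x" "continuous_on (x ` U) (inv_into U x)"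
    and "p \<in> U \<Longrightarrow> inv_into U x (x p) = p"
    and "z \<in> x ` U \<Longrightarrow> inv_into U x z \<in> U"
    and "z \<in> x ` U \<Longrightarrow> x (inv_into U x z) = z"
proof -
  have c: "is_chart (U, x)" using assms atlas by (auto simp: smooth_atlas_def)
  then show "open U" "open (x ` U)" "continuous_on U x" "continuous_on (x ` U) (inv_into U x)"
    and "p \<in> U \<Longrightarrow> inv_into U x (x p) = p"
    by (auto simp: is_chart_def homeomorphism_def)
  show "z \<in> x ` U \<Longrightarrow> inv_into U x z \<in> U" "z \<in> x ` U \<Longrightarrow> x (inv_into U x z) = z"
    by (auto intro: inv_into_into f_inv_into_f)
qed

lemma chart_exists: obtains U x where "(U, x) \<in> A" "p \<in> U"
proof -
  have "p \<in> (\<Union>c\<in>A. fst c)" using atlas by (simp add: smooth_atlas_def)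
  then show ?thesis using that by force
qed

lemma open_chart_image:
  assumes "(U, x) \<in> A" "open W"
  shows "open (x ` (U \<inter> W))"
proof -
  have "x ` (U \<inter> W) = x ` U \<inter> inv_into U x -` W"
    using chart_homeomorphism[OF assms(1)] by (auto simp: image_iff)
  then show ?thesis
    using continuous_on_open_vimage[OF chart_homeomorphism(2)[OF assms(1)], of "inv_into U x"]
      chart_homeomorphism(4)[OF assms(1)] assms(2) by (metis Int_commute)
qed

text \<open>Near \<open>s0\<close> the map factors through a chart \<open>w\<close> around
  \<open>\<Phi> s0\<close>. The set \<open>D\<close> is where \<open>h\<close> is smooth in charts:
  if \<open>h\<close> is a family read off in a second chart, it is where the values lie in that
  chart domain; if \<open>h\<close> is a real function of time and position, it is
  \<open>I \<times> UNIV\<close>.\<close>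

lemma smooth_on_through_charts:
  fixes \<tau> :: "'a::euclidean_space \<Rightarrow> real"
  assumes S: "accessible S" and \<Phi>: "mfd_smooth_on A S \<Phi>" and \<tau>: "smooth_on S \<tau>"
    and D: "\<And>s. s \<in> S \<Longrightarrow> (\<tau> s, \<Phi> s) \<in> D"
    and h: "\<And>W w. (W, w) \<in> A \<Longrightarrow>
      smooth_on {(t, z). z \<in> w ` W \<and> (t, inv_into W w z) \<in> D} (\<lambda>(t, z). h t (inv_into W w z))"
  shows "smooth_on S (\<lambda>s. h (\<tau> s) (\<Phi> s))"
proof (rule smooth_on_local)
  fix s0 assume s0: "s0 \<in> S"
  obtain W w where W: "(W, w) \<in> A" "\<Phi> s0 \<in> W" using chart_exists by metis
  note ch = chart_homeomorphism[OF W(1)]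
  obtain N where N: "open N" "{s\<in>S. \<Phi> s \<in> W} = S \<inter> N"
    using preimage_relatively_open[OF mfd_smooth_onD(1)[OF \<Phi>] ch(1)] by metis
  have acc: "accessible (S \<inter> N)" using accessible_Int_open[OF S N(1)] .
  have chi: "w (\<Phi> s) \<in> w ` W" "inv_into W w (w (\<Phi> s)) = \<Phi> s" if "s \<in> S \<inter> N" for s
    using that N(2) ch(5) by blast+
  have "smooth_on (S \<inter> N) (\<lambda>s. w (\<Phi> s))"
    using mfd_smooth_onD(2)[OF \<Phi> W(1)] N(2) by simp
  then have "smooth_on (S \<inter> N) (\<lambda>s. (\<tau> s, w (\<Phi> s)))"
    by (intro smooth_on_Pair[OF acc] smooth_on_Int_open[OF \<tau> N(1)])
  then have "smooth_on (S \<inter> N) (\<lambda>s. case (\<tau> s, w (\<Phi> s)) of (t, z) \<Rightarrow> h t (inv_into W w z))"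
    by (rule smooth_on_compose[OF acc _ h[OF W(1)]]) (use chi D in auto)
  then have "smooth_on (S \<inter> N) (\<lambda>s. h (\<tau> s) (\<Phi> s))"
    by (rule smooth_on_cong[rotated]) (use chi in auto)
  then show "\<exists>N. open N \<and> s0 \<in> N \<and> smooth_on (S \<inter> N) (\<lambda>s. h (\<tau> s) (\<Phi> s))"
    using N W s0 by blast
qed

lemma mfd_smooth_on_Int_open:
  assumes "mfd_smooth_on A S \<Phi>" "open N"
  shows "mfd_smooth_on A (S \<inter> N) \<Phi>"
proof (rule mfd_smooth_onI)
  show "continuous_on (S \<inter> N) \<Phi>"
    using mfd_smooth_onD(1)[OF assms(1)] continuous_on_subset by blast
  fix V y assume V: "(V, y) \<in> A"
  have eq: "{s \<in> S \<inter> N. \<Phi> s \<in> V} = {s \<in> S. \<Phi> s \<in> V} \<inter> N" by auto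
  show "smooth_on {s \<in> S \<inter> N. \<Phi> s \<in> V} (\<lambda>s. y (\<Phi> s))"
    unfolding eq by (rule smooth_on_Int_open[OF mfd_smooth_onD(2)[OF assms(1) V] assms(2)])
qed

lemma smooth_family_mfd_smoothI:
  assumes "continuous_on (I \<times> UNIV) (\<lambda>(t, p). \<phi> t p)"
    and "\<And>U x. (U, x) \<in> A \<Longrightarrow> mfd_smooth_on A (I \<times> x ` U) (\<lambda>(t, z). \<phi> t (inv_into U x z))"
  shows "smooth_family A I \<phi>"
  using assms by (auto simp: smooth_family_def)

lemma smooth_familyD:
  assumes "smooth_family A I \<phi>"
  shows "continuous_on (I \<times> UNIV) (\<lambda>(t, p). \<phi> t p)"
    and "(U, x) \<in> A \<Longrightarrow> mfd_smooth_on A (I \<times> x ` U) (\<lambda>(t, z). \<phi> t (inv_into U x z))"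
  using assms by (auto simp: smooth_family_def)

lemma smooth_family_chartD:
  assumes "smooth_family A I \<phi>" "(U, x) \<in> A" "(V, y) \<in> A"
  shows "smooth_on {(t, z). t \<in> I \<and> z \<in> x ` U \<and> \<phi> t (inv_into U x z) \<in> V}
    (\<lambda>(t, z). y (\<phi> t (inv_into U x z)))"
proof -
  have "{s \<in> I \<times> x ` U. (case s of (t, z) \<Rightarrow> \<phi> t (inv_into U x z)) \<in> V}
      = {(t, z). t \<in> I \<and> z \<in> x ` U \<and> \<phi> t (inv_into U x z) \<in> V}"
    by auto
  then show ?thesis
    using mfd_smooth_onD(2)[OF smooth_familyD(2)[OF assms(1,2)] assms(3)]
    by (simp add: case_prod_unfold)
qed

lemma continuous_on_chart_cylinder:
  assumes cont: "continuous_on (I \<times> UNIV) (\<lambda>(t, p). \<phi> t p)" and U: "(U, x) \<in> A"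
  shows "continuous_on (I \<times> x ` U) (\<lambda>(t, z). \<phi> t (inv_into U x z))"
proof -
  have "continuous_on (I \<times> x ` U) (\<lambda>s. (fst s, inv_into U x (snd s)))"
    by (intro continuous_on_Pair continuous_on_fst continuous_on_id
        continuous_on_compose2[OF chart_homeomorphism(4)[OF U]] continuous_on_snd) auto
  then have "continuous_on (I \<times> x ` U)
      (\<lambda>s. (case (fst s, inv_into U x (snd s)) of (t, p) \<Rightarrow> \<phi> t p))"
    by (rule continuous_on_compose2[OF cont]) auto
  then show ?thesis
    by (simp add: case_prod_unfold)
qed

lemma smooth_familyI:
  assumes cont: "continuous_on (I \<times> UNIV) (\<lambda>(t, p). \<phi> t p)"
    and "\<And>U x V y. (U, x) \<in> A \<Longrightarrow> (V, y) \<in> A \<Longrightarrow>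
      smooth_on {(t, z). t \<in> I \<and> z \<in> x ` U \<and> \<phi> t (inv_into U x z) \<in> V}
        (\<lambda>(t, z). y (\<phi> t (inv_into U x z)))"
  shows "smooth_family A I \<phi>"
proof (rule smooth_family_mfd_smoothI[OF cont])
  fix U x assume U: "(U, x) \<in> A"
  show "mfd_smooth_on A (I \<times> x ` U) (\<lambda>(t, z). \<phi> t (inv_into U x z))"
  proof (rule mfd_smooth_onI)
    show "continuous_on (I \<times> x ` U) (\<lambda>(t, z). \<phi> t (inv_into U x z))"
      using continuous_on_chart_cylinder[OF cont U] .
    fix V y assume V: "(V, y) \<in> A"
    have "{s \<in> I \<times> x ` U. (case s of (t, z) \<Rightarrow> \<phi> t (inv_into U x z)) \<in> V}
        = {(t, z). t \<in> I \<and> z \<in> x ` U \<and> \<phi> t (inv_into U x z) \<in> V}"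
      by auto
    then show "smooth_on {s \<in> I \<times> x ` U. (case s of (t, z) \<Rightarrow> \<phi> t (inv_into U x z)) \<in> V}
        (\<lambda>s. y (case s of (t, z) \<Rightarrow> \<phi> t (inv_into U x z)))"
      using assms(2)[OF U V] by (simp add: case_prod_unfold)
  qed
qed

lemma smooth_diff_curve_iff:
  "smooth_diff_curve A I \<phi> \<longleftrightarrow> (\<forall>t\<in>I. \<phi> t \<in> carrier (diff_group A)) \<and> smooth_family A I \<phi>"
proof
  assume "smooth_diff_curve A I \<phi>"
  then show "(\<forall>t\<in>I. \<phi> t \<in> carrier (diff_group A)) \<and> smooth_family A I \<phi>"
    unfolding smooth_diff_curve_def by (intro conjI smooth_familyI) auto
next
  assume "(\<forall>t\<in>I. \<phi> t \<in> carrier (diff_group A)) \<and> smooth_family A I \<phi>"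
  then show "smooth_diff_curve A I \<phi>"
    unfolding smooth_diff_curve_def using smooth_familyD(1)[of I \<phi>] smooth_family_chartD[of I \<phi>] by auto
qed

lemma smooth_family_apply:
  fixes \<tau> :: "'a::euclidean_space \<Rightarrow> real"
  assumes S: "accessible S" and \<Phi>: "mfd_smooth_on A S \<Phi>" and \<tau>: "smooth_on S \<tau>" "\<tau> ` S \<subseteq> I"
    and \<phi>: "smooth_family A I \<phi>"
  shows "mfd_smooth_on A S (\<lambda>s. \<phi> (\<tau> s) (\<Phi> s))"
proof (rule mfd_smooth_onI)
  have "continuous_on S (\<lambda>s. (\<tau> s, \<Phi> s))"
    using smooth_on_continuous[OF \<tau>(1)] mfd_smooth_onD(1)[OF \<Phi>] by (intro continuous_on_Pair)
  then have "continuous_on S (\<lambda>s. (case (\<tau> s, \<Phi> s) of (t, p) \<Rightarrow> \<phi> t p))"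
    by (rule continuous_on_compose2[OF smooth_familyD(1)[OF \<phi>]]) (use \<tau>(2) in auto)
  then show cont: "continuous_on S (\<lambda>s. \<phi> (\<tau> s) (\<Phi> s))" by simp
  fix V y assume V: "(V, y) \<in> A"
  obtain N where N: "open N" "{s\<in>S. \<phi> (\<tau> s) (\<Phi> s) \<in> V} = S \<inter> N"
    using preimage_relatively_open[OF cont chart_homeomorphism(1)[OF V]] by metis
  have "smooth_on (S \<inter> N) (\<lambda>s. (\<lambda>t p. y (\<phi> t p)) (\<tau> s) (\<Phi> s))"
  proof (rule smooth_on_through_charts[where \<tau> = \<tau> and \<Phi> = \<Phi> and h = "\<lambda>t p. y (\<phi> t p)"
      and D = "{(t, p). t \<in> I \<and> \<phi> t p \<in> V}"])
    show "accessible (S \<inter> N)" using accessible_Int_open[OF S N(1)] .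
    show "mfd_smooth_on A (S \<inter> N) \<Phi>" using mfd_smooth_on_Int_open[OF \<Phi> N(1)] .
    show "smooth_on (S \<inter> N) \<tau>" using smooth_on_Int_open[OF \<tau>(1) N(1)] .
    show "(\<tau> s, \<Phi> s) \<in> {(t, p). t \<in> I \<and> \<phi> t p \<in> V}" if "s \<in> S \<inter> N" for s
      using that N(2) \<tau>(2) by auto
    fix W w assume "(W, w) \<in> A"
    then show "smooth_on {(t, z). z \<in> w ` W \<and> (t, inv_into W w z) \<in> {(t, p). t \<in> I \<and> \<phi> t p \<in> V}}
        (\<lambda>(t, z). y (\<phi> t (inv_into W w z)))"
      using smooth_family_chartD[OF \<phi> _ V, of W w] by (simp add: conj_left_commute)
  qed
  then show "smooth_on {s\<in>S. \<phi> (\<tau> s) (\<Phi> s) \<in> V} (\<lambda>s. y (\<phi> (\<tau> s) (\<Phi> s)))"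
    using N(2) by simp
qed

lemma smooth_time_function_apply:
  fixes \<tau> :: "'a::euclidean_space \<Rightarrow> real"
  assumes S: "accessible S" and \<Phi>: "mfd_smooth_on A S \<Phi>" and \<tau>: "smooth_on S \<tau>" "\<tau> ` S \<subseteq> I"
    and F: "smooth_time_function A I F"
  shows "smooth_on S (\<lambda>s. F (\<tau> s) (\<Phi> s))"
proof (rule smooth_on_through_charts[OF S \<Phi> \<tau>(1), where D = "I \<times> UNIV"])
  fix W w assume "(W, w) \<in> A"
  moreover have "{(t, z). z \<in> w ` W \<and> (t, inv_into W w z) \<in> I \<times> UNIV} = I \<times> w ` W"
    by auto
  ultimately show "smooth_on {(t, z). z \<in> w ` W \<and> (t, inv_into W w z) \<in> I \<times> UNIV}
      (\<lambda>(t, z). F t (inv_into W w z))"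
    using F by (auto simp: smooth_time_function_def)
qed (use \<tau>(2) in auto)

lemma accessible_chart_cylinder:
  assumes "interval_about_0 I" "(U, x) \<in> A"
  shows "accessible (I \<times> x ` U)"
  by (intro accessible_Times accessible_interval accessible_open assms
      chart_homeomorphism(2)[OF assms(2)])

lemma smooth_time_function_const:
  assumes "interval_about_0 I" "f \<in> smooth_functions A"
  shows "smooth_time_function A I (\<lambda>t. f)"
  unfolding smooth_time_function_def
proof clarify
  fix U x assume U: "(U, x) \<in> A"
  have "smooth_on (I \<times> x ` U) (\<lambda>s. f (inv_into U x (snd s)))"
    by (rule smooth_on_compose[where T = "x ` U" and f = snd, OF _ smooth_on_snd])
      (use accessible_chart_cylinder[OF assms(1) U] assms(2) U in \<open>auto simp: smooth_functions_def\<close>)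
  then show "smooth_on (I \<times> x ` U) (\<lambda>(t, z). f (inv_into U x z))"
    by (simp add: case_prod_unfold)
qed

lemma smooth_family_id:
  assumes "interval_about_0 I"
  shows "smooth_family A I (\<lambda>t. id)"
proof (rule smooth_familyI)
  show "continuous_on (I \<times> UNIV) (\<lambda>(t, p). id p)"
    by (simp add: case_prod_unfold continuous_on_snd)
  fix U x V y assume U: "(U, x) \<in> A" and V: "(V, y) \<in> A"
  have eq: "{(t, z). t \<in> I \<and> z \<in> x ` U \<and> id (inv_into U x z) \<in> V} = I \<times> x ` (U \<inter> V)"
    using chart_homeomorphism[OF U] by (auto simp: image_iff)
  have acc: "accessible (I \<times> x ` (U \<inter> V))"
    using open_chart_image[OF U chart_homeomorphism(1)[OF V]]
    by (intro accessible_Times accessible_interval accessible_open assms)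
  have "smooth_on (I \<times> x ` (U \<inter> V)) (\<lambda>s. y (inv_into U x (snd s)))"
    by (rule smooth_on_compose[where T = "x ` (U \<inter> V)" and f = snd, OF acc smooth_on_snd[OF acc]])
      (use atlas U V in \<open>auto simp: smooth_atlas_def\<close>)
  then show "smooth_on {(t, z). t \<in> I \<and> z \<in> x ` U \<and> id (inv_into U x z) \<in> V}
        (\<lambda>(t, z). y (id (inv_into U x z)))"
    unfolding eq by (simp add: case_prod_unfold)
qed

text \<open>Composition of two families is the case where \<open>\<theta>\<close> is the identity, a
  change of time the case where \<open>\<psi>\<close> is the constant family
  \<open>id\<close>.\<close>

lemma smooth_family_compose_gen:
  assumes J: "interval_about_0 J" and \<phi>: "smooth_family A I \<phi>" and \<psi>: "smooth_family A J \<psi>"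
    and \<theta>: "smooth_on J \<theta>" "\<theta> ` J \<subseteq> I"
  shows "smooth_family A J (\<lambda>t p. \<phi> (\<theta> t) (\<psi> t p))"
proof (rule smooth_family_mfd_smoothI)
  have "continuous_on (J \<times> UNIV) (\<lambda>s. (\<theta> (fst s), case s of (t, p) \<Rightarrow> \<psi> t p))"
    by (intro continuous_on_Pair continuous_on_compose2[OF smooth_on_continuous[OF \<theta>(1)]]
        smooth_familyD(1)[OF \<psi>] continuous_on_fst continuous_on_id) auto
  then have "continuous_on (J \<times> UNIV)
      (\<lambda>s. case (\<theta> (fst s), case s of (t, p) \<Rightarrow> \<psi> t p) of (t, p) \<Rightarrow> \<phi> t p)"
    by (rule continuous_on_compose2[OF smooth_familyD(1)[OF \<phi>]]) (use \<theta>(2) in auto)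
  then show "continuous_on (J \<times> UNIV) (\<lambda>(t, p). \<phi> (\<theta> t) (\<psi> t p))"
    by (simp add: case_prod_unfold)
  fix U x assume U: "(U, x) \<in> A"
  note acc = accessible_chart_cylinder[OF J U]
  have "smooth_on (J \<times> x ` U) (\<lambda>s. \<theta> (fst s))"
    by (rule smooth_on_compose[OF acc smooth_on_fst[OF acc] \<theta>(1)]) auto
  moreover have "(\<lambda>s. \<theta> (fst s)) ` (J \<times> x ` U) \<subseteq> I"
    using \<theta>(2) by auto
  ultimately show "mfd_smooth_on A (J \<times> x ` U) (\<lambda>(t, z). \<phi> (\<theta> t) (\<psi> t (inv_into U x z)))"
    using smooth_family_apply[OF acc smooth_familyD(2)[OF \<psi> U] _ _ \<phi>]
    by (simp add: case_prod_unfold)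
qed

lemma smooth_family_compose:
  assumes "interval_about_0 I" "smooth_family A I \<phi>" "smooth_family A I \<psi>"
  shows "smooth_family A I (\<lambda>t. \<phi> t \<circ> \<psi> t)"
  using smooth_family_compose_gen[OF assms, of "\<lambda>t. t"]
    smooth_on_bounded_linear[OF accessible_interval[OF assms(1)] bounded_linear_ident]
  by (simp add: comp_def)

lemma smooth_family_reparametrise:
  assumes "interval_about_0 J" "smooth_family A I \<phi>" "smooth_on J \<theta>" "\<theta> ` J \<subseteq> I"
  shows "smooth_family A J (\<lambda>t. \<phi> (\<theta> t))"
  using smooth_family_compose_gen[OF assms(1,2) smooth_family_id[OF assms(1)] assms(3,4)] by simp

lemma smooth_curve_orbit:
  assumes I: "interval_about_0 I" and \<phi>: "smooth_family A I \<phi>"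
  shows "smooth_curve A I (\<lambda>t. \<phi> t p)"
proof -
  note acc = accessible_interval[OF I]
  \<comment> \<open>The set \<open>{s \<in> I. p \<in> V}\<close> is either \<open>I\<close> or
    empty, and both are accessible.\<close>
  have "smooth_on {s \<in> I. p \<in> V} (\<lambda>s. y p)" for V :: "'m set" and y :: "'m \<Rightarrow> 'e"
    by (rule smooth_on_const) (use acc in \<open>cases "p \<in> V"; simp add: accessible_def\<close>)
  then have "mfd_smooth_on A I (\<lambda>t. p)"
    by (auto simp: mfd_smooth_on_def)
  from smooth_family_apply[OF acc this smooth_on_bounded_linear[OF acc bounded_linear_ident] _ \<phi>]
  show ?thesis by (simp add: mfd_smooth_on_def smooth_curve_def)
qed

lemma smooth_time_function_compose:
  assumes I: "interval_about_0 I" and F: "smooth_time_function A I F" and \<phi>: "smooth_family A I \<phi>"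
  shows "smooth_time_function A I (\<lambda>t p. F t (\<phi> t p))"
  unfolding smooth_time_function_def
proof clarify
  fix U x assume U: "(U, x) \<in> A"
  note acc = accessible_chart_cylinder[OF I U]
  from smooth_time_function_apply[OF acc smooth_familyD(2)[OF \<phi> U] smooth_on_fst[OF acc] _ F]
  show "smooth_on (I \<times> x ` U) (\<lambda>(t, z). F t (\<phi> t (inv_into U x z)))"
    by (auto simp: case_prod_unfold)
qed

text \<open>The map \<open>(t, p) \<mapsto> (t, \<phi> t p)\<close> is a continuous bijection of a
  compact space onto a Hausdorff one, so its inverse is continuous. In charts its derivative is
  injective: a kernel vector has no time component, and its space component is detected by the
  smooth inverse of the single diffeomorphism \<open>\<phi> t\<close>.\<close>

lemma smooth_family_inverse:
  assumes comp: "compact (UNIV :: 'm set)" "compact I" and I: "interval_about_0 I"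
    and \<phi>: "smooth_diff_curve A I \<phi>"
  shows "smooth_family A I (\<lambda>t. inv_into UNIV (\<phi> t))"
proof (rule smooth_familyI)
  define \<psi> where "\<psi> = (\<lambda>t. inv_into UNIV (\<phi> t))"
  have fam: "smooth_family A I \<phi>" and diff: "\<And>t. t \<in> I \<Longrightarrow> \<phi> t \<in> carrier (diff_group A)"
    using \<phi> by (auto simp: smooth_diff_curve_iff)
  have bij: "bij (\<phi> t)" and smooth: "smooth_map A (\<phi> t)" "smooth_map A (\<psi> t)" if "t \<in> I" for t
    using diff[OF that] by (auto simp: diff_group_def \<psi>_def)
  have inverse: "\<psi> t (\<phi> t p) = p" "\<phi> t (\<psi> t p) = p" if "t \<in> I" for t p
    using bij[OF that] by (auto simp: \<psi>_def bij_is_inj bij_is_surj surj_f_inv_f)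
  define \<Phi> where "\<Phi> = (\<lambda>(t, p). (t, \<phi> t p))"
  have "continuous_on (I \<times> UNIV) \<Phi>"
    using continuous_on_Pair[OF continuous_on_fst[OF continuous_on_id] smooth_familyD(1)[OF fam]]
    by (simp add: \<Phi>_def case_prod_unfold)
  then have "continuous_on (\<Phi> ` (I \<times> UNIV)) (\<lambda>(t, p). (t, \<psi> t p))"
    by (rule continuous_on_inv) (use comp inverse in \<open>auto simp: \<Phi>_def intro: compact_Times\<close>)
  moreover have "\<Phi> ` (I \<times> UNIV) = I \<times> UNIV"
  proof (intro equalityI subsetI)
    fix s assume "s \<in> I \<times> (UNIV :: 'm set)"
    then show "s \<in> \<Phi> ` (I \<times> UNIV)"
      using inverse(2) by (intro image_eqI[of _ _ "(fst s, \<psi> (fst s) (snd s))"]) (auto simp: \<Phi>_def)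
  qed (auto simp: \<Phi>_def)
  ultimately have "continuous_on (I \<times> UNIV) (\<lambda>s. snd (case s of (t, p) \<Rightarrow> (t, \<psi> t p)))"
    by (intro continuous_on_snd) simp
  then have \<psi>cont: "continuous_on (I \<times> UNIV) (\<lambda>(t, p). \<psi> t p)"
    by (simp add: case_prod_unfold)
  then show "continuous_on (I \<times> UNIV) (\<lambda>(t, p). inv_into UNIV (\<phi> t) p)"
    by (simp add: \<psi>_def)
  fix U x V y assume U: "(U, x) \<in> A" and V: "(V, y) \<in> A"
  note chU = chart_homeomorphism[OF U] and chV = chart_homeomorphism[OF V]
  define S where "S = {(t, z). t \<in> I \<and> z \<in> x ` U \<and> \<psi> t (inv_into U x z) \<in> V}"
  define T where "T = {(t, w). t \<in> I \<and> w \<in> y ` V \<and> \<phi> t (inv_into V y w) \<in> U}"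
  \<comment> \<open>Keeping the time as first coordinate makes \<open>F\<close> a map between sets
    of equal dimension, so injectivity of its derivative is enough to invert that
    derivative.\<close>
  define F where "F = (\<lambda>(t, w). (t, x (\<phi> t (inv_into V y w))))"
  define G where "G = (\<lambda>(t, z). (t, y (\<psi> t (inv_into U x z))))"
  have accS: "accessible S"
  proof -
    obtain N where "open N"
      "{s \<in> I \<times> x ` U. (case s of (t, z) \<Rightarrow> \<psi> t (inv_into U x z)) \<in> V} = (I \<times> x ` U) \<inter> N"
      by (rule preimage_relatively_open[OF continuous_on_chart_cylinder[OF \<psi>cont U] chV(1)])
    moreover have "S = {s \<in> I \<times> x ` U. (case s of (t, z) \<Rightarrow> \<psi> t (inv_into U x z)) \<in> V}"
      by (auto simp: S_def)
    ultimately show ?thesis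
      using accessible_Int_open[OF accessible_chart_cylinder[OF I U]] by simp
  qed
  have accT: "accessible T"
  proof -
    obtain N where "open N"
      "{s \<in> I \<times> y ` V. (case s of (t, z) \<Rightarrow> \<phi> t (inv_into V y z)) \<in> U} = (I \<times> y ` V) \<inter> N"
      by (rule preimage_relatively_open[OF
            continuous_on_chart_cylinder[OF smooth_familyD(1)[OF fam] V] chU(1)])
    moreover have "T = {s \<in> I \<times> y ` V. (case s of (t, z) \<Rightarrow> \<phi> t (inv_into V y z)) \<in> U}"
      by (auto simp: T_def)
    ultimately show ?thesis
      using accessible_Int_open[OF accessible_chart_cylinder[OF I V]] by simp
  qed
  have F: "smooth_on T F"
    using smooth_on_Pair[OF accT smooth_on_fst[OF accT]] smooth_family_chartD[OF fam V U]
    unfolding F_def T_def by (simp add: case_prod_unfold)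
  have FS: "F s \<in> S" and GF: "G (F s) = s" if s: "s \<in> T" for s
  proof -
    obtain t w where s_eq: "s = (t, w)" and t: "t \<in> I" and w: "w \<in> y ` V"
      and U': "\<phi> t (inv_into V y w) \<in> U"
      using s by (auto simp: T_def)
    show "F s \<in> S" "G (F s) = s"
      using t w U' chU(5)[OF U'] chV(6,7)[OF w] inverse(1)[OF t]
      by (auto simp: s_eq F_def S_def G_def)
  qed
  have GT: "G s \<in> T" and FG: "F (G s) = s" if s: "s \<in> S" for s
  proof -
    obtain t z where s_eq: "s = (t, z)" and t: "t \<in> I" and z: "z \<in> x ` U"
      and V': "\<psi> t (inv_into U x z) \<in> V"
      using s by (auto simp: S_def)
    show "G s \<in> T" "F (G s) = s"
      using t z V' chV(5)[OF V'] chU(6,7)[OF z] inverse(2)[OF t]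
      by (auto simp: s_eq F_def T_def G_def)
  qed
  have "F ` T = S"
  proof (intro equalityI subsetI)
    fix s assume "s \<in> S"
    then show "s \<in> F ` T"
      by (intro image_eqI[of _ _ "G s"]) (simp_all add: FG GT)
  qed (use FS in blast)
  have contG: "continuous_on S G"
  proof -
    have "continuous_on S (\<lambda>s. case s of (t, z) \<Rightarrow> \<psi> t (inv_into U x z))"
      by (rule continuous_on_subset[OF continuous_on_chart_cylinder[OF \<psi>cont U]]) (auto simp: S_def)
    then have "continuous_on S (\<lambda>s. y (case s of (t, z) \<Rightarrow> \<psi> t (inv_into U x z)))"
      by (rule continuous_on_compose2[OF chV(3)]) (auto simp: S_def)
    then show ?thesis
      using continuous_on_Pair[OF continuous_on_fst[OF continuous_on_id]]
      unfolding G_def by (simp add: case_prod_unfold)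
  qed
  have inj: "v = 0" if s: "s \<in> T" and v: "frechet_derivative F (at s within T) v = 0" for s v
  proof -
    define D where "D = frechet_derivative F (at s within T)"
    have D: "(F has_derivative D) (at s within T)"
      unfolding D_def by (rule smooth_on_has_derivative[OF F s])
    obtain t w where s_eq: "s = (t, w)" and t: "t \<in> I" and w: "w \<in> y ` V"
      and U': "\<phi> t (inv_into V y w) \<in> U"
      using s by (auto simp: T_def)
    \<comment> \<open>The first coordinate of \<open>F\<close> is the time itself, so the time
      component of a kernel vector vanishes.\<close>
    have "((\<lambda>s. fst (F s)) has_derivative (\<lambda>v. fst (D v))) (at s within T)"
      by (rule bounded_linear.has_derivative[OF bounded_linear_fst D])
    moreover have "(\<lambda>s. fst (F s)) = fst" by (auto simp: F_def)
    moreover have "(fst has_derivative fst) (at s within T)"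
      by (rule bounded_linear_imp_has_derivative[OF bounded_linear_fst])
    ultimately have "(\<lambda>v. fst (D v)) = fst"
      using accessible_derivative_unique[OF accT s] by metis
    then have fst_v: "fst v = 0"
      using v D_def by (metis fst_zero)
    \<comment> \<open>Time is now frozen at \<open>t\<close>: \<open>Tt\<close> is the slice of
      \<open>T\<close>, and \<open>St\<close> is the domain of the chart form \<open>h\<close> of
      the inverse of \<open>\<phi> t\<close>.\<close>
    define Tt where "Tt = y ` (V \<inter> \<phi> t -` U)"
    define St where "St = x ` (U \<inter> \<psi> t -` V)"
    have "continuous_on UNIV (\<phi> t)"
      using smooth(1)[OF t] unfolding smooth_map_def by (rule conjunct1)
    then have "open Tt"
      unfolding Tt_def by (intro open_chart_image[OF V] open_vimage[OF chU(1)])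
    then have accTt: "accessible Tt" by (rule accessible_open)
    have Tt_iff: "w' \<in> Tt \<longleftrightarrow> (t, w') \<in> T" for w'
      using t chV(5,6,7) by (auto simp: Tt_def T_def image_iff)
    have wTt: "w \<in> Tt" using s s_eq Tt_iff by simp
    have "((\<lambda>w'. (t, w')) has_derivative (\<lambda>u. (0, u))) (at w within Tt)"
      by (intro has_derivative_Pair has_derivative_const has_derivative_ident)
    then have "((\<lambda>w'. F (t, w')) has_derivative (\<lambda>u. D (0, u))) (at w within Tt)"
      unfolding D_def s_eq
      by (rule has_derivative_in_compose2[OF smooth_on_has_derivative[OF F], rotated 3])
        (use Tt_iff wTt in auto)
    then have f: "((\<lambda>w'. snd (F (t, w'))) has_derivative (\<lambda>u. snd (D (0, u)))) (at w within Tt)"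
      by (rule bounded_linear.has_derivative[OF bounded_linear_snd])
    define h where "h = (\<lambda>z. y (\<psi> t (inv_into U x z)))"
    have h: "smooth_on St h"
      using smooth(2)[OF t] U V unfolding smooth_map_def St_def h_def by auto
    have fSt: "snd (F (t, w')) \<in> St" and hf: "h (snd (F (t, w'))) = w'" if "w' \<in> Tt" for w'
    proof -
      have *: "(t, w') \<in> T" using that Tt_iff by simp
      show "h (snd (F (t, w'))) = w'"
        using GF[OF *] by (simp add: G_def F_def h_def)
      have U'': "\<phi> t (inv_into V y w') \<in> U" "w' \<in> y ` V" using * by (auto simp: T_def)
      then show "snd (F (t, w')) \<in> St"
        using inverse(1)[OF t] chV(6) by (auto simp: St_def F_def)
    qed
    define H where "H = frechet_derivative h (at (snd (F (t, w))) within St)"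
    have H: "(h has_derivative H) (at (snd (F (t, w))) within St)"
      unfolding H_def by (rule smooth_on_has_derivative[OF h fSt[OF wTt]])
    have "((\<lambda>w'. h (snd (F (t, w')))) has_derivative (\<lambda>u. H (snd (D (0, u))))) (at w within Tt)"
      by (rule has_derivative_in_compose[OF f has_derivative_subset[OF H]]) (use fSt in auto)
    then have "((\<lambda>w'. w') has_derivative (\<lambda>u. H (snd (D (0, u))))) (at w within Tt)"
      by (rule has_derivative_transform[OF wTt, rotated]) (simp add: hf)
    \<comment> \<open>Differentiating \<open>h (snd (F (t, w'))) = w'\<close> has produced a left
      inverse of the space part of \<open>D\<close>, so \<open>D (0, u) = 0\<close> forces
      \<open>u = 0\<close>.\<close>
    then have "(\<lambda>u. H (snd (D (0, u)))) = (\<lambda>u. u)"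
      using accessible_derivative_unique[OF accTt wTt _ has_derivative_ident] by blast
    then have "snd v = H (snd (D (0, snd v)))" by metis
    also have "(0, snd v) = v" using fst_v by (metis prod.collapse)
    also have "H (snd (D v)) = 0"
      using v has_derivative_linear[OF H] by (simp add: D_def linear_0)
    finally show "v = 0" using fst_v by (simp add: prod_eq_iff)
  qed
  have "smooth_on S G"
    by (rule smooth_on_inverse[OF accS accT F \<open>F ` T = S\<close> contG GF inj])
  then have "smooth_on S (\<lambda>s. snd (G s))"
    by (rule smooth_on_compose[OF accS _ smooth_on_snd[OF accessible_UNIV]]) auto
  then show "smooth_on {(t, z). t \<in> I \<and> z \<in> x ` U \<and> inv_into UNIV (\<phi> t) (inv_into U x z) \<in> V}
        (\<lambda>(t, z). y (inv_into UNIV (\<phi> t) (inv_into U x z)))"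
    by (simp add: S_def G_def \<psi>_def case_prod_unfold)
qed

end

section \<open>Taylor expansion in the time variable\<close>

text \<open>The derivative of the remainder is the remainder, of order one less, for the shifted
  sequence \<open>g (Suc i)\<close>, so induction and the mean value inequality give the bound.
  Measuring the error by the oscillation \<open>M\<close> of the top derivative makes the estimate
  uniform in a parameter.\<close>

lemma taylor_remainder_bound:
  fixes g :: "nat \<Rightarrow> real \<Rightarrow> real"
  assumes I: "is_interval I" "0 \<in> I" "t \<in> I"
    and der: "\<And>i s. \<lbrakk>i < n; s \<in> I\<rbrakk> \<Longrightarrow> (g i has_field_derivative g (Suc i) s) (at s within I)"
    and M: "\<And>s. s \<in> closed_segment 0 t \<Longrightarrow> \<bar>g n s - g n 0\<bar> \<le> M"
  shows "\<bar>g 0 t - (\<Sum>i\<le>n. t ^ i / fact i * g i 0)\<bar> \<le> \<bar>t\<bar> ^ n * M"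
  using I(3) der M
proof (induction n arbitrary: g t)
  case 0
  then show ?case by simp
next
  case (Suc n)
  define R where "R = (\<lambda>s. g 0 s - (\<Sum>i\<le>Suc n. s ^ i / fact i * g i 0))"
  define R' where "R' = (\<lambda>s. g (Suc 0) s - (\<Sum>i\<le>n. s ^ i / fact i * g (Suc i) 0))"
  have seg: "closed_segment 0 t \<subseteq> I"
    using I Suc.prems(1) by (simp add: closed_segment_subset is_interval_convex)
  have R_eq: "R s = g 0 s - (g 0 0 + (\<Sum>i\<le>n. s ^ Suc i / fact (Suc i) * g (Suc i) 0))" for s
    unfolding R_def sum.atMost_Suc_shift by simp
  have monomial: "((\<lambda>s. s ^ Suc i / fact (Suc i) * c) has_field_derivative s ^ i / fact i * c) (at s within X)"
    for i s and c :: real and X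
    by (rule DERIV_cong[OF DERIV_cmult_right[OF DERIV_cdivide[OF DERIV_pow]]])
      (simp add: fact_Suc del: of_nat_Suc)
  have R': "(R has_field_derivative R' s) (at s within closed_segment 0 t)" if "s \<in> closed_segment 0 t" for s
  proof -
    have "(g 0 has_field_derivative g (Suc 0) s) (at s within closed_segment 0 t)"
      using Suc.prems(2)[of 0 s] that seg by (auto intro: DERIV_subset)
    then have "((\<lambda>s. g 0 s - (g 0 0 + (\<Sum>i\<le>n. s ^ Suc i / fact (Suc i) * g (Suc i) 0)))
        has_field_derivative g (Suc 0) s - (0 + (\<Sum>i\<le>n. s ^ i / fact i * g (Suc i) 0)))
        (at s within closed_segment 0 t)"
      by (intro DERIV_diff DERIV_add DERIV_const DERIV_sum monomial)
    then show ?thesis unfolding R'_def R_eq[abs_def] by simp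
  qed
  have bound: "norm (R' s) \<le> \<bar>t\<bar> ^ n * M" if s: "s \<in> closed_segment 0 t" for s
  proof -
    have sub: "closed_segment 0 s \<subseteq> closed_segment 0 t"
      using s by (simp add: subset_closed_segment)
    have "\<bar>R' s\<bar> \<le> \<bar>s\<bar> ^ n * M"
      unfolding R'_def by (rule Suc.IH[of s "\<lambda>i. g (Suc i)"]) (use Suc.prems s seg sub in auto)
    moreover have "\<bar>s\<bar> \<le> \<bar>t\<bar>"
      using s by (auto simp: closed_segment_eq_real_ivl split: if_splits)
    moreover have "0 \<le> M"
      using Suc.prems(3)[of 0] by simp
    ultimately show ?thesis
      by (smt (verit) mult_right_mono power_mono abs_ge_zero real_norm_def)
  qed
  have "norm (R t - R 0) \<le> \<bar>t\<bar> ^ n * M * norm (t - 0)"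
    by (rule field_differentiable_bound[OF _ R' bound]) auto
  moreover have "R 0 = 0" by (simp add: R_eq)
  ultimately have "\<bar>R t\<bar> \<le> \<bar>t\<bar> ^ Suc n * M" by (simp add: mult_ac)
  then show ?case unfolding R_def .
qed

section \<open>Time derivatives and Taylor expansion uniform in the base point\<close>

lemma nth_deriv_0 [simp]: "nth_deriv I 0 g = g"
  by (simp add: nth_deriv_def)

lemma nth_deriv_Suc: "nth_deriv I (Suc n) g = (\<lambda>t. vector_derivative (nth_deriv I n g) (at t within I))"
  by (simp add: nth_deriv_def)

text \<open>Gives uniqueness of limits and of vector derivatives within \<open>I\<close>, also at an
  end point.\<close>

lemma interval_about_0_not_trivial:
  assumes "interval_about_0 I" "t \<in> I"
  shows "at t within I \<noteq> bot"
proof -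
  have "t islimpt I"
    unfolding islimpt_approachable
  proof (intro allI impI)
    fix e :: real assume "0 < e"
    then obtain d where "0 < \<bar>d\<bar>" "\<bar>d\<bar> < e" "t + d *\<^sub>R 1 \<in> I"
      using accessible_interval[OF assms(1), unfolded accessible_def, rule_format, OF assms(2), of 1 e]
      by auto
    then show "\<exists>s\<in>I. s \<noteq> t \<and> dist s t < e"
      by (intro bexI[of _ "t + d"]) (auto simp: dist_real_def)
  qed
  then show ?thesis by (simp add: trivial_limit_within)
qed

lemma interval_about_0_closed_segment:
  assumes "interval_about_0 I" "t \<in> I"
  shows "closed_segment 0 t \<subseteq> I"
  using assms by (simp add: interval_about_0_def closed_segment_subset is_interval_convex)

context smooth_manifold
begin

text \<open>In a chart the time derivative is the directional derivative in the direction
  \<open>(1, 0)\<close>, hence jointly smooth in time and position. This is how every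
  \<open>nth_deriv\<close> stays a smooth time function.\<close>

lemma smooth_time_function_has_derivative:
  assumes I: "interval_about_0 I" and F: "smooth_time_function A I F" and U: "(U, x) \<in> A"
    and t: "t \<in> I" and z: "z \<in> x ` U"
  shows "((\<lambda>s. F s (inv_into U x z)) has_vector_derivative
    frechet_derivative (\<lambda>(t, z). F t (inv_into U x z)) (at (t, z) within I \<times> x ` U) (1, 0)) (at t within I)"
proof -
  define h where "h = (\<lambda>(t, z). F t (inv_into U x z))"
  define D where "D = frechet_derivative h (at (t, z) within I \<times> x ` U)"
  have h: "smooth_on (I \<times> x ` U) h"
    using F U by (auto simp: smooth_time_function_def h_def)
  have "(t, z) \<in> I \<times> x ` U" using t z by simp
  note D = smooth_on_has_derivative[OF h this, folded D_def]
  have "((\<lambda>s. (s, z)) has_derivative (\<lambda>d. (d, 0))) (at t within I)"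
    by (intro has_derivative_Pair has_derivative_const has_derivative_ident)
  moreover have "(h has_derivative D) (at (t, z) within (\<lambda>s. (s, z)) ` I)"
    by (rule has_derivative_subset[OF D]) (use z in auto)
  ultimately have "((\<lambda>s. h (s, z)) has_derivative (\<lambda>d. D (d, 0))) (at t within I)"
    by (rule has_derivative_in_compose)
  moreover have "(\<lambda>d. D (d, 0)) = (\<lambda>d. d *\<^sub>R D (1, 0))"
  proof
    show "D (d, 0) = d *\<^sub>R D (1, 0)" for d
      using linear_scale[OF has_derivative_linear[OF D], of d "(1, 0)"] by simp
  qed
  ultimately show ?thesis
    unfolding has_vector_derivative_def D_def h_def by simp
qed

lemma chart_point: obtains U x z where "(U, x) \<in> A" "z \<in> x ` U" "p = inv_into U x z"
proof -
  obtain U x where U: "(U, x) \<in> A" "p \<in> U" by (rule chart_exists)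
  then show ?thesis
    using that[of U x "x p"] chart_homeomorphism(5)[OF U] by simp
qed

lemma smooth_time_function_vector_derivative:
  assumes I: "interval_about_0 I" and F: "smooth_time_function A I F"
  shows "t \<in> I \<Longrightarrow> ((\<lambda>s. F s p) has_vector_derivative
      vector_derivative (\<lambda>s. F s p) (at t within I)) (at t within I)"
    and "smooth_time_function A I (\<lambda>t p. vector_derivative (\<lambda>s. F s p) (at t within I))"
proof -
  show "((\<lambda>s. F s p) has_vector_derivative
      vector_derivative (\<lambda>s. F s p) (at t within I)) (at t within I)" if t: "t \<in> I"
  proof -
    obtain U x z where U: "(U, x) \<in> A" "z \<in> x ` U" "p = inv_into U x z"
      by (rule chart_point)
    note differentiableI_vector[OF smooth_time_function_has_derivative[OF I F U(1) t U(2)]]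
    then show ?thesis
      unfolding U(3) by (rule vector_derivative_works[THEN iffD1])
  qed
  show "smooth_time_function A I (\<lambda>t p. vector_derivative (\<lambda>s. F s p) (at t within I))"
    unfolding smooth_time_function_def
  proof clarify
    fix U x assume U: "(U, x) \<in> A"
    define h where "h = (\<lambda>(t, z). F t (inv_into U x z))"
    have "smooth_on (I \<times> x ` U) h"
      using F U by (auto simp: smooth_time_function_def h_def)
    then have "smooth_on (I \<times> x ` U) (\<lambda>s. frechet_derivative h (at s within I \<times> x ` U) (1, 0))"
      by (rule smooth_on_frechet_derivative)
    then show "smooth_on (I \<times> x ` U)
        (\<lambda>(t, z). vector_derivative (\<lambda>s. F s (inv_into U x z)) (at t within I))"
    proof (rule smooth_on_cong[rotated], clarify)
      fix t p assume "t \<in> I" "p \<in> U"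
      then show "frechet_derivative h (at (t, x p) within I \<times> x ` U) (1, 0)
          = vector_derivative (\<lambda>s. F s (inv_into U x (x p))) (at t within I)"
        using vector_derivative_within[OF interval_about_0_not_trivial[OF I]
            smooth_time_function_has_derivative[OF I F U]] by (simp add: h_def)
    qed
  qed
qed

lemma smooth_time_function_nth_deriv:
  assumes I: "interval_about_0 I" and F: "smooth_time_function A I F"
  shows "smooth_time_function A I (\<lambda>t p. nth_deriv I n (\<lambda>s. F s p) t)"
proof (induction n)
  case 0
  then show ?case using F by simp
next
  case (Suc n)
  then show ?case
    using smooth_time_function_vector_derivative(2)[OF I Suc] by (simp add: nth_deriv_Suc)
qed

lemma smooth_time_function_nth_deriv_has_derivative:
  assumes I: "interval_about_0 I" and F: "smooth_time_function A I F" and "t \<in> I"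
  shows "(nth_deriv I n (\<lambda>s. F s p) has_field_derivative nth_deriv I (Suc n) (\<lambda>s. F s p) t) (at t within I)"
  using smooth_time_function_vector_derivative(1)[OF I smooth_time_function_nth_deriv[OF I F, where n = n]
      assms(3), where p = p]
  unfolding nth_deriv_Suc has_real_derivative_iff_has_vector_derivative .

lemma smooth_time_function_smooth_functions:
  assumes I: "interval_about_0 I" and F: "smooth_time_function A I F" and t: "t \<in> I"
  shows "F t \<in> smooth_functions A"
  unfolding smooth_functions_def
proof (safe)
  fix U x assume U: "(U, x) \<in> A"
  have acc: "accessible (x ` U)"
    using accessible_open chart_homeomorphism(2)[OF U] .
  have h: "smooth_on (I \<times> x ` U) (\<lambda>(t, z). F t (inv_into U x z))"
    using F U by (auto simp: smooth_time_function_def)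
  have "smooth_on (x ` U) (\<lambda>z. (t, z))"
    using smooth_on_bounded_linear[OF acc bounded_linear_ident]
    by (intro smooth_on_Pair smooth_on_const acc)
  then have "smooth_on (x ` U) (\<lambda>z. (case (t, z) of (t, z) \<Rightarrow> F t (inv_into U x z)))"
    by (rule smooth_on_compose[OF acc _ h]) (use t in auto)
  then show "smooth_on (x ` U) (\<lambda>z. F t (inv_into U x z))" by simp
qed

lemma smooth_time_function_continuous_at:
  assumes F: "smooth_time_function A I F" and t: "t \<in> I" and e: "e > 0"
  obtains N where "open N" "(t, p) \<in> N"
    "\<forall>(s, q) \<in> N. s \<in> I \<longrightarrow> \<bar>F s q - F t p\<bar> < e"
proof -
  obtain U x where U: "(U, x) \<in> A" "p \<in> U" using chart_exists by metis
  note ch = chart_homeomorphism[OF U(1)]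
  have "continuous_on (I \<times> x ` U) (\<lambda>(t, z). F t (inv_into U x z))"
    using F U by (auto simp: smooth_time_function_def intro: smooth_on_continuous)
  moreover have "continuous_on (I \<times> U) (\<lambda>s. (fst s, x (snd s)))"
    by (intro continuous_on_Pair continuous_on_fst continuous_on_id
        continuous_on_compose2[OF ch(3)] continuous_on_snd) auto
  ultimately have "continuous_on (I \<times> U)
      (\<lambda>s. (case (fst s, x (snd s)) of (t, z) \<Rightarrow> F t (inv_into U x z)))"
    by (rule continuous_on_compose2) auto
  then have cont: "continuous_on (I \<times> U) (\<lambda>s. F (fst s) (snd s))"
    by (rule continuous_on_eq) (use ch in auto)
  obtain N where N: "open N" "{s \<in> I \<times> U. F (fst s) (snd s) \<in> ball (F t p) e} = (I \<times> U) \<inter> N"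
    by (rule preimage_relatively_open[OF cont open_ball])
  have "(t, p) \<in> {s \<in> I \<times> U. F (fst s) (snd s) \<in> ball (F t p) e}"
    using t U e by simp
  then have mem: "(t, p) \<in> N \<inter> (UNIV \<times> U)" unfolding N(2) by simp
  show ?thesis
  proof (rule that[OF _ mem])
    show "open (N \<inter> (UNIV \<times> U))"
      using N(1) ch(1) by (intro open_Int open_Times) auto
    have "\<bar>F s q - F t p\<bar> < e" if "s \<in> I" "(s, q) \<in> N \<inter> (UNIV \<times> U)" for s q
    proof -
      have "(s, q) \<in> {s \<in> I \<times> U. F (fst s) (snd s) \<in> ball (F t p) e}"
        unfolding N(2) using that by simp
      then show ?thesis
        by (simp add: dist_real_def abs_minus_commute)
    qed
    then show "\<forall>(s, q) \<in> N \<inter> (UNIV \<times> U). s \<in> I \<longrightarrow> \<bar>F s q - F t p\<bar> < e"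
      by blast
  qed
qed

text \<open>The coefficients are taken at the moving point \<open>q\<close>, not at
  \<open>p\<close>, so the quotient contains the true Taylor remainder at \<open>q\<close>. It is
  small near \<open>(0, p)\<close> because the n-th time derivative is jointly continuous
  there.\<close>

lemma smooth_time_function_taylor:
  assumes I: "interval_about_0 I" and F: "smooth_time_function A I F"
  shows "((\<lambda>(t, q). (F t q - (\<Sum>i\<le>n. t ^ i / fact i * nth_deriv I i (\<lambda>s. F s q) 0)) / t ^ n) \<longlongrightarrow> 0)
    ((at 0 within I) \<times>\<^sub>F nhds p)"
proof (rule tendstoI)
  fix e :: real assume e: "e > 0"
  have zero: "0 \<in> I" using I by (simp add: interval_about_0_def)
  define Fn where "Fn = (\<lambda>t q. nth_deriv I n (\<lambda>s. F s q) t)"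
  have Fn: "smooth_time_function A I Fn"
    unfolding Fn_def by (rule smooth_time_function_nth_deriv[OF I F])
  \<comment> \<open>The values at \<open>(s, q)\<close> and \<open>(0, q)\<close> are each within
    \<open>e / 4\<close> of the value at \<open>(0, p)\<close>, so the oscillation is at most
    \<open>e / 2\<close>, which leaves room for the strict bound by \<open>e\<close>.\<close>
  have e4: "0 < e / 4" using e by simp
  obtain N where N: "open N" "(0, p) \<in> N"
    "\<forall>(s, q) \<in> N. s \<in> I \<longrightarrow> \<bar>Fn s q - Fn 0 p\<bar> < e / 4"
    by (rule smooth_time_function_continuous_at[OF Fn zero e4, of p])
  obtain T W where TW': "open T" "open W" "(0, p) \<in> T \<times> W" "T \<times> W \<subseteq> N"
    by (rule open_prod_elim[OF N(1,2)])
  then have TW: "open T" "open W" "0 \<in> T" "p \<in> W" by simp_all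
  obtain d where d: "d > 0" "ball 0 d \<subseteq> T" by (rule openE[OF TW(1,3)])
  have "\<forall>\<^sub>F t in at 0 within I. t \<in> I \<and> t \<noteq> 0 \<and> \<bar>t\<bar> < d"
    unfolding eventually_at using d(1) by (auto intro!: exI[of _ d] simp: dist_real_def)
  moreover have "\<forall>\<^sub>F q in nhds p. q \<in> W"
    by (rule eventually_nhds_in_open[OF TW(2,4)])
  ultimately have "\<forall>\<^sub>F (t, q) in (at 0 within I) \<times>\<^sub>F nhds p. (t \<in> I \<and> t \<noteq> 0 \<and> \<bar>t\<bar> < d) \<and> q \<in> W"
    unfolding eventually_prod_filter case_prod_unfold by fastforce
  then show "\<forall>\<^sub>F s in (at 0 within I) \<times>\<^sub>F nhds p. dist
      (case s of (t, q) \<Rightarrow> (F t q - (\<Sum>i\<le>n. t ^ i / fact i * nth_deriv I i (\<lambda>s. F s q) 0)) / t ^ n) 0 < e"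
  proof (rule eventually_mono, clarify)
    fix t q assume t: "t \<in> I" "t \<noteq> 0" "\<bar>t\<bar> < d" and q: "q \<in> W"
    have close: "\<bar>Fn s q - Fn 0 p\<bar> < e / 4" if "s \<in> closed_segment 0 t" for s
    proof -
      have sI: "s \<in> I" using that interval_about_0_closed_segment[OF I t(1)] by blast
      have "\<bar>s\<bar> < d"
        using that t(3) by (auto simp: closed_segment_eq_real_ivl split: if_splits)
      then have "(s, q) \<in> N" using d(2) q TW'(4) by (auto simp: dist_real_def)
      then show ?thesis using N(3) sI by blast
    qed
    have "\<bar>Fn s q - Fn 0 q\<bar> \<le> e / 2" if "s \<in> closed_segment 0 t" for s
      using close[OF that] close[OF ends_in_segment(1)] by linarith
    then have "\<bar>F t q - (\<Sum>i\<le>n. t ^ i / fact i * nth_deriv I i (\<lambda>s. F s q) 0)\<bar> \<le> \<bar>t\<bar> ^ n * (e / 2)"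
      using taylor_remainder_bound[of I t n "\<lambda>i. nth_deriv I i (\<lambda>s. F s q)" "e/2"] I t(1)
        smooth_time_function_nth_deriv_has_derivative[OF I F]
      by (simp add: interval_about_0_def Fn_def)
    then have "\<bar>(F t q - (\<Sum>i\<le>n. t ^ i / fact i * nth_deriv I i (\<lambda>s. F s q) 0)) / t ^ n\<bar> \<le> e / 2"
      using t(2) by (simp add: abs_divide power_abs field_simps)
    then show "dist ((F t q - (\<Sum>i\<le>n. t ^ i / fact i * nth_deriv I i (\<lambda>s. F s q) 0)) / t ^ n) 0 < e"
      using e unfolding dist_real_def by linarith
  qed
qed

end

section \<open>Leading terms of families of diffeomorphisms\<close>

lemma tendsto_along_family:
  fixes \<Phi> :: "real \<Rightarrow> 'a::topological_space \<Rightarrow> 'b::topological_space"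
  assumes cont: "continuous_on (I \<times> UNIV) (\<lambda>(t, p). \<Phi> t p)" and zero: "0 \<in> I"
  shows "((\<lambda>(t, q). \<Phi> t q) \<longlongrightarrow> \<Phi> 0 p) ((at 0 within I) \<times>\<^sub>F nhds p)"
proof (rule topological_tendstoI)
  fix V :: "'b set" assume V: "open V" "\<Phi> 0 p \<in> V"
  obtain N where N: "open N" "{s \<in> I \<times> UNIV. (case s of (t, p) \<Rightarrow> \<Phi> t p) \<in> V} = (I \<times> UNIV) \<inter> N"
    by (rule preimage_relatively_open[OF cont V(1)])
  have "(0, p) \<in> {s \<in> I \<times> UNIV. (case s of (t, p) \<Rightarrow> \<Phi> t p) \<in> V}"
    using V(2) zero by simp
  then have "(0, p) \<in> N" unfolding N(2) by simp
  then obtain T W where TW: "open T" "open W" "(0, p) \<in> T \<times> W" "T \<times> W \<subseteq> N"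
    by (rule open_prod_elim[OF N(1)])
  have *: "\<Phi> t q \<in> V" if "t \<in> T" "t \<in> I" "q \<in> W" for t q
  proof -
    have "(t, q) \<in> (I \<times> UNIV) \<inter> N" using that TW(4) by auto
    then show ?thesis unfolding N(2)[symmetric] by simp
  qed
  have "\<forall>\<^sub>F t in at 0 within I. t \<in> T \<and> t \<in> I"
    unfolding eventually_at_topological using TW by auto
  moreover have "\<forall>\<^sub>F q in nhds p. q \<in> W"
    using TW by (auto intro: eventually_nhds_in_open)
  ultimately show "\<forall>\<^sub>F s in (at 0 within I) \<times>\<^sub>F nhds p. (case s of (t, q) \<Rightarrow> \<Phi> t q) \<in> V"
    unfolding eventually_prod_filter using * by fastforce
qed

lemma eventually_time_nonzero:
  "\<forall>\<^sub>F (t, q) in (at 0 within I) \<times>\<^sub>F F. t \<in> I \<and> t \<noteq> (0::real)"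
proof -
  have "\<forall>\<^sub>F t in at 0 within I. t \<in> I \<and> t \<noteq> (0::real)"
    unfolding eventually_at_topological by auto
  then have "\<forall>\<^sub>F s in (at 0 within I) \<times>\<^sub>F F. fst s \<in> I \<and> fst s \<noteq> (0::real)"
    using filterlim_fst[of "at 0 within I" F] unfolding filterlim_iff by auto
  then show ?thesis by (simp add: case_prod_unfold)
qed

lemma filterlim_time_slice:
  "filterlim (\<lambda>t. (t, p)) ((at 0 within I) \<times>\<^sub>F nhds p) (at 0 within (I :: real set))"
  by (intro filterlim_Pair filterlim_ident tendsto_const)

text \<open>Points near \<open>p\<close> stay near \<open>p\<close> for small times, so in any limit
  over this filter the base point \<open>q\<close> may be replaced by
  \<open>\<Phi> t q\<close>.\<close>

lemma filterlim_family:
  fixes \<Phi> :: "real \<Rightarrow> 'a::topological_space \<Rightarrow> 'a"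
  assumes "continuous_on (I \<times> UNIV) (\<lambda>(t, p). \<Phi> t p)" "0 \<in> I" "\<Phi> 0 = id"
  shows "filterlim (\<lambda>(t, q). (t, \<Phi> t q)) ((at 0 within I) \<times>\<^sub>F nhds p) ((at 0 within I) \<times>\<^sub>F nhds p)"
proof -
  have "filterlim (\<lambda>s. (fst s, \<Phi> (fst s) (snd s))) ((at 0 within I) \<times>\<^sub>F nhds p) ((at 0 within I) \<times>\<^sub>F nhds p)"
    using tendsto_along_family[OF assms(1,2), of p] assms(3)
    by (intro filterlim_Pair filterlim_fst) (simp add: case_prod_unfold)
  then show ?thesis by (simp add: case_prod_unfold)
qed

lemma taylor_sum_leading:
  fixes c :: "nat \<Rightarrow> real"
  assumes "m \<ge> 1" "\<And>i. \<lbrakk>1 \<le> i; i < m\<rbrakk> \<Longrightarrow> c i = 0"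
  shows "(\<Sum>i\<le>m. t ^ i / fact i * c i) = c 0 + t ^ m / fact m * c m"
proof -
  have "(\<Sum>i\<le>m. t ^ i / fact i * c i) = (\<Sum>i\<in>{0, m}. t ^ i / fact i * c i)"
    using assms by (intro sum.mono_neutral_right) auto
  then show ?thesis using assms(1) by simp
qed

context smooth_manifold
begin

text \<open>The limit is uniform in the base point, in the sense of a limit in \<open>(t, q) \<rightarrow> (0, p)\<close>; this is
  what makes it stable under composition of families.\<close>

definition expansion :: "real set \<Rightarrow> (real \<Rightarrow> 'm \<Rightarrow> 'm) \<Rightarrow> nat \<Rightarrow> 'm vfield \<Rightarrow> bool" where
  "expansion I \<phi> k X \<longleftrightarrow> (\<forall>f\<in>smooth_functions A. \<forall>p.
     ((\<lambda>(t, q). (f (\<phi> t q) - f q) / t ^ k) \<longlongrightarrow> X p f) ((at 0 within I) \<times>\<^sub>F nhds p))"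

lemma expansionD:
  assumes "expansion I \<phi> k X" "f \<in> smooth_functions A"
  shows "((\<lambda>s. (f (\<phi> (fst s) (snd s)) - f (snd s)) / fst s ^ k) \<longlongrightarrow> X p f) ((at 0 within I) \<times>\<^sub>F nhds p)"
  using assms by (auto simp: expansion_def case_prod_unfold)

lemma expansionI:
  assumes "\<And>f p. f \<in> smooth_functions A \<Longrightarrow>
    ((\<lambda>s. (f (\<phi> (fst s) (snd s)) - f (snd s)) / fst s ^ k) \<longlongrightarrow> X p f) ((at 0 within I) \<times>\<^sub>F nhds p)"
  shows "expansion I \<phi> k X"
  using assms by (auto simp: expansion_def case_prod_unfold)

section \<open>From integral curves to leading terms and back\<close>

lemma smooth_function_tendsto:
  assumes "f \<in> smooth_functions A"
  shows "(f \<longlongrightarrow> f p) (nhds p)"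
proof -
  obtain U x where U: "(U, x) \<in> A" "p \<in> U" by (rule chart_exists)
  note ch = chart_homeomorphism[OF U(1)]
  have "continuous_on (x ` U) (\<lambda>z. f (inv_into U x z))"
    using assms U(1) by (auto simp: smooth_functions_def intro: smooth_on_continuous)
  then have "continuous_on U (\<lambda>q. f (inv_into U x (x q)))"
    by (rule continuous_on_compose2[OF _ ch(3)]) auto
  then have "continuous_on U f"
    by (rule continuous_on_eq) (use ch in auto)
  then show ?thesis
    using ch(1) U(2) by (metis continuous_on_eq_continuous_at isCont_def tendsto_at_iff_tendsto_nhds)
qed

lemma smooth_time_function_pullback:
  assumes "interval_about_0 I" "smooth_family A I \<phi>" "f \<in> smooth_functions A"
  shows "smooth_time_function A I (\<lambda>t q. f (\<phi> t q))"
  by (rule smooth_time_function_compose[OF assms(1) smooth_time_function_const[OF assms(1,3)] assms(2)])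

text \<open>The Taylor polynomial of order \<open>k\<close> at \<open>q\<close> has at most two
  nonzero terms, and its top coefficient is \<open>X q f / fact k\<close>; this is the origin of the
  factor. Replacing \<open>X q f\<close> by \<open>X p f\<close> in the limit uses continuity of
  \<open>\<lambda>q. X q f\<close>, where smoothness of the vector field enters.\<close>

lemma integral_curve_expansion:
  assumes curve: "integral_curve A I \<phi> X" and X: "X \<in> vector_fields A"
  obtains k where "k \<ge> 1" "expansion I \<phi> k (vf_scale (1 / fact k) X)"
proof -
  have I: "interval_about_0 I" and fam: "smooth_family A I \<phi>" and \<phi>0: "\<phi> 0 = id"
    using curve by (auto simp: integral_curve_def smooth_diff_curve_iff)
  obtain k where k: "k \<ge> 1"
    and c: "\<And>p. kth_order_integral_curve A k I (\<lambda>t. \<phi> t p) p (X p)"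
    using curve by (auto simp: integral_curve_def)
  have "expansion I \<phi> k (vf_scale (1 / fact k) X)"
  proof (rule expansionI)
    fix f p assume f: "f \<in> smooth_functions A"
    note F = smooth_time_function_pullback[OF I fam f]
    have low: "nth_deriv I i (\<lambda>s. f (\<phi> s q)) 0 = 0" if "1 \<le> i" "i < k" for i q
      using c[of q] that f unfolding kth_order_integral_curve_def curve_deriv_0_def fun_eq_iff by metis
    have top: "nth_deriv I k (\<lambda>s. f (\<phi> s q)) 0 = X q f" for q
      using c[of q] f unfolding kth_order_integral_curve_def curve_deriv_0_def fun_eq_iff by metis
    have sum: "(\<Sum>i\<le>k. t ^ i / fact i * nth_deriv I i (\<lambda>s. f (\<phi> s q)) 0) = f q + t ^ k / fact k * X q f" for t q
      using taylor_sum_leading[OF k, of "\<lambda>i. nth_deriv I i (\<lambda>s. f (\<phi> s q)) 0"] low top \<phi>0 by simp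
    have rem: "((\<lambda>s. (f (\<phi> (fst s) (snd s)) - (f (snd s) + fst s ^ k / fact k * X (snd s) f)) / fst s ^ k) \<longlongrightarrow> 0)
        ((at 0 within I) \<times>\<^sub>F nhds p)"
      using smooth_time_function_taylor[OF I F, of k p]
      unfolding sum case_prod_unfold .
    have "(\<lambda>q. X q f) \<in> smooth_functions A"
      using X f by (simp add: vector_fields_def)
    from smooth_function_tendsto[OF this, of p]
    have "((\<lambda>s. X (snd s) f) \<longlongrightarrow> X p f) ((at 0 within I) \<times>\<^sub>F nhds p)"
      by (rule filterlim_compose[OF _ filterlim_snd])
    then have "((\<lambda>s. 1 / fact k * X (snd s) f) \<longlongrightarrow> 1 / fact k * X p f) ((at 0 within I) \<times>\<^sub>F nhds p)"
      by (rule tendsto_mult_left)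
    from tendsto_add[OF rem this]
    have lim: "((\<lambda>s. (f (\<phi> (fst s) (snd s)) - (f (snd s) + fst s ^ k / fact k * X (snd s) f)) / fst s ^ k
        + 1 / fact k * X (snd s) f) \<longlongrightarrow> vf_scale (1 / fact k) X p f) ((at 0 within I) \<times>\<^sub>F nhds p)"
      by (simp add: vf_scale_def)
    have "\<forall>\<^sub>F s in (at 0 within I) \<times>\<^sub>F nhds p.
        (f (\<phi> (fst s) (snd s)) - (f (snd s) + fst s ^ k / fact k * X (snd s) f)) / fst s ^ k
        + 1 / fact k * X (snd s) f = (f (\<phi> (fst s) (snd s)) - f (snd s)) / fst s ^ k"
      using eventually_time_nonzero[of I "nhds p"]
      by (rule eventually_mono) (auto simp: field_simps)
    then show "((\<lambda>s. (f (\<phi> (fst s) (snd s)) - f (snd s)) / fst s ^ k) \<longlongrightarrow> vf_scale (1 / fact k) X p f)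
        ((at 0 within I) \<times>\<^sub>F nhds p)"
      by (rule Lim_transform_eventually[OF lim])
  qed
  then show ?thesis using that k by blast
qed

text \<open>The limit determines the Taylor coefficients at a fixed \<open>p\<close>. If those of
  orders 1 to m - 1 vanish, the quotient by \<open>t ^ m\<close> tends to
  \<open>c m / fact m\<close>; for \<open>m < k\<close> the expansion forces this limit to be 0, and
  for \<open>m = k\<close> it is \<open>X p f\<close>.\<close>

lemma expansion_nth_deriv:
  assumes I: "interval_about_0 I" and fam: "smooth_family A I \<phi>" and \<phi>0: "\<phi> 0 = id" and k: "k \<ge> 1"
    and ex: "expansion I \<phi> k X" and f: "f \<in> smooth_functions A"
  shows "\<lbrakk>1 \<le> m; m < k\<rbrakk> \<Longrightarrow> nth_deriv I m (\<lambda>s. f (\<phi> s p)) 0 = 0"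
    and "nth_deriv I k (\<lambda>s. f (\<phi> s p)) 0 = fact k * X p f"
proof -
  define g where "g = (\<lambda>t. f (\<phi> t p))"
  define c where "c = (\<lambda>i. nth_deriv I i g 0)"
  have zero: "0 \<in> I" using I by (simp add: interval_about_0_def)
  note nontriv = interval_about_0_not_trivial[OF I zero]
  have nonzero: "\<forall>\<^sub>F t in at 0 within I. t \<noteq> 0"
    unfolding eventually_at_topological by auto
  have L: "((\<lambda>t. (g t - f p) / t ^ k) \<longlongrightarrow> X p f) (at 0 within I)"
    using filterlim_compose[OF expansionD[OF ex f] filterlim_time_slice, of p] by (simp add: g_def)
  have lead: "((\<lambda>t. (g t - f p) / t ^ m) \<longlongrightarrow> c m / fact m) (at 0 within I)"
    if m: "1 \<le> m" and low: "\<And>i. \<lbrakk>1 \<le> i; i < m\<rbrakk> \<Longrightarrow> c i = 0" for m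
  proof -
    have "c 0 = f p" by (simp add: c_def g_def \<phi>0)
    then have sum: "(\<Sum>i\<le>m. t ^ i / fact i * c i) = f p + t ^ m / fact m * c m" for t
      using taylor_sum_leading[OF m low] by simp
    have "((\<lambda>t. (g t - (\<Sum>i\<le>m. t ^ i / fact i * c i)) / t ^ m) \<longlongrightarrow> 0) (at 0 within I)"
      using filterlim_compose[OF smooth_time_function_taylor[OF I smooth_time_function_pullback[OF I fam f], of m]
          filterlim_time_slice, of p]
      by (simp add: g_def c_def)
    from tendsto_add[OF this tendsto_const[of "c m / fact m"]]
    have lim: "((\<lambda>t. (g t - (f p + t ^ m / fact m * c m)) / t ^ m + c m / fact m) \<longlongrightarrow> c m / fact m) (at 0 within I)"
      by (simp only: sum add_0)
    have "\<forall>\<^sub>F t in at 0 within I.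
        (g t - (f p + t ^ m / fact m * c m)) / t ^ m + c m / fact m = (g t - f p) / t ^ m"
      using nonzero by (rule eventually_mono) (auto simp: field_simps)
    then show ?thesis by (rule Lim_transform_eventually[OF lim])
  qed
  have low: "1 \<le> m \<longrightarrow> m < k \<longrightarrow> c m = 0" for m
  proof (induction m rule: less_induct)
    case (less m)
    show ?case
    proof (intro impI)
      assume m: "1 \<le> m" "m < k"
      \<comment> \<open>The quotient by \<open>t ^ m\<close> is the convergent quotient by
        \<open>t ^ k\<close> times a positive power of \<open>t\<close>.\<close>
      have "((\<lambda>t. (g t - f p) / t ^ k * t ^ (k - m)) \<longlongrightarrow> X p f * 0 ^ (k - m)) (at 0 within I)"
        by (intro tendsto_intros L)
      moreover have "X p f * 0 ^ (k - m) = 0"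
        using m by (simp add: power_0_left)
      ultimately have lim: "((\<lambda>t. (g t - f p) / t ^ k * t ^ (k - m)) \<longlongrightarrow> 0) (at 0 within I)"
        by metis
      have "\<forall>\<^sub>F t in at 0 within I. (g t - f p) / t ^ k * t ^ (k - m) = (g t - f p) / t ^ m"
        using nonzero
      proof (rule eventually_mono)
        fix t :: real assume "t \<noteq> 0"
        moreover have "t ^ k = t ^ m * t ^ (k - m)"
          using m by (simp flip: power_add)
        ultimately show "(g t - f p) / t ^ k * t ^ (k - m) = (g t - f p) / t ^ m"
          by simp
      qed
      then have "((\<lambda>t. (g t - f p) / t ^ m) \<longlongrightarrow> 0) (at 0 within I)"
        by (rule Lim_transform_eventually[OF lim])
      moreover have "((\<lambda>t. (g t - f p) / t ^ m) \<longlongrightarrow> c m / fact m) (at 0 within I)"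
        using less m by (intro lead) auto
      ultimately have "c m / fact m = 0"
        using tendsto_unique[OF nontriv] by blast
      then show "c m = 0" by simp
    qed
  qed
  then show "\<lbrakk>1 \<le> m; m < k\<rbrakk> \<Longrightarrow> nth_deriv I m (\<lambda>s. f (\<phi> s p)) 0 = 0"
    by (auto simp: c_def g_def)
  have "X p f = c k / fact k"
    using tendsto_unique[OF nontriv L lead[OF k]] low by blast
  then show "nth_deriv I k (\<lambda>s. f (\<phi> s p)) 0 = fact k * X p f"
    by (simp add: c_def g_def)
qed

lemma expansion_integral_curve:
  assumes I: "interval_about_0 I" and \<phi>: "smooth_diff_curve A I \<phi>" and \<phi>0: "\<phi> 0 = id" and k: "k \<ge> 1"
    and X: "X \<in> vector_fields A" and ex: "expansion I \<phi> k (vf_scale (1 / fact k) X)"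
  shows "integral_curve A I \<phi> X"
proof -
  have fam: "smooth_family A I \<phi>" using \<phi> by (simp add: smooth_diff_curve_iff)
  note deriv = expansion_nth_deriv[OF I fam \<phi>0 k ex]
  have "kth_order_integral_curve A k I (\<lambda>t. \<phi> t p) p (X p)" for p
    unfolding kth_order_integral_curve_def
  proof (intro conjI allI impI)
    have Xp: "X p \<in> tangent_space A p" using X by (simp add: vector_fields_def)
    then show "X p \<in> tangent_space A p" .
    have X0: "X p f = 0" if "f \<notin> smooth_functions A" for f
      using Xp that by (simp add: tangent_space_def)
    show "curve_deriv_0 A I (\<lambda>t. \<phi> t p) i = (\<lambda>f. 0)" if "1 \<le> i \<and> i < k" for i
      using deriv(1) that by (auto simp: curve_deriv_0_def fun_eq_iff)
    show "curve_deriv_0 A I (\<lambda>t. \<phi> t p) k = X p"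
      using deriv(2) X0 by (auto simp: curve_deriv_0_def fun_eq_iff vf_scale_def)
  qed (use I \<phi>0 smooth_curve_orbit[OF I fam] in auto)
  then show ?thesis
    using I \<phi> \<phi>0 k by (auto simp: integral_curve_def)
qed

end

lemma filterlim_monomial_within:
  fixes b :: real
  assumes "b \<noteq> 0" "l \<ge> 1" "\<And>t. t \<in> J \<Longrightarrow> b * t ^ l \<in> I"
  shows "filterlim (\<lambda>t. b * t ^ l) (at 0 within I) (at 0 within J)"
  unfolding filterlim_at
proof
  have "((\<lambda>t. b * t ^ l) \<longlongrightarrow> b * 0 ^ l) (at 0 within J)"
    by (intro tendsto_intros)
  then show "((\<lambda>t. b * t ^ l) \<longlongrightarrow> 0) (at 0 within J)"
    using assms(2) by (simp add: power_0_left)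
  show "\<forall>\<^sub>F t in at 0 within J. b * t ^ l \<in> I \<and> b * t ^ l \<noteq> 0"
    unfolding eventually_at_topological using assms(1,3) by (intro exI[of _ UNIV]) auto
qed

lemma smooth_on_monomial:
  fixes b :: real
  assumes "accessible J"
  shows "smooth_on J (\<lambda>t. b * t ^ l)"
proof (induction l)
  case 0
  then show ?case using smooth_on_const[OF assms] by simp
next
  case (Suc l)
  have "smooth_on J (\<lambda>t. t * (b * t ^ l))"
    by (intro smooth_on_mult assms Suc smooth_on_bounded_linear bounded_linear_ident)
  then show ?case by (simp add: mult_ac)
qed

context smooth_manifold
begin

section \<open>Smooth functions and the Lie algebra of vector fields\<close>

lemma smooth_functions_const: "(\<lambda>q. c) \<in> smooth_functions A"
  unfolding smooth_functions_def
  by (auto intro!: smooth_on_const accessible_open chart_homeomorphism(2))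

lemma smooth_functions_add:
  assumes "f \<in> smooth_functions A" "g \<in> smooth_functions A"
  shows "(\<lambda>q. f q + g q) \<in> smooth_functions A"
  using assms unfolding smooth_functions_def
  by (auto intro!: smooth_on_add accessible_open chart_homeomorphism(2))

lemma smooth_functions_mult:
  assumes "f \<in> smooth_functions A" "g \<in> smooth_functions A"
  shows "(\<lambda>q. f q * g q) \<in> smooth_functions A"
  using assms unfolding smooth_functions_def
  by (auto intro!: smooth_on_mult accessible_open chart_homeomorphism(2))

lemma smooth_functions_scale:
  assumes "f \<in> smooth_functions A"
  shows "(\<lambda>q. c * f q) \<in> smooth_functions A"
  by (rule smooth_functions_mult[OF smooth_functions_const assms])

lemma smooth_functions_diff:
  assumes "f \<in> smooth_functions A" "g \<in> smooth_functions A"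
  shows "(\<lambda>q. f q - g q) \<in> smooth_functions A"
  using smooth_functions_add[OF assms(1) smooth_functions_scale[OF assms(2), of "-1"]] by simp

lemma vector_fieldD:
  assumes "X \<in> vector_fields A"
  shows "\<lbrakk>f \<in> smooth_functions A; g \<in> smooth_functions A\<rbrakk> \<Longrightarrow> X p (\<lambda>q. f q + g q) = X p f + X p g"
    and "f \<in> smooth_functions A \<Longrightarrow> X p (\<lambda>q. a * f q) = a * X p f"
    and "\<lbrakk>f \<in> smooth_functions A; g \<in> smooth_functions A\<rbrakk> \<Longrightarrow>
      X p (\<lambda>q. f q * g q) = f p * X p g + g p * X p f"
    and "f \<notin> smooth_functions A \<Longrightarrow> X p f = 0"
    and "f \<in> smooth_functions A \<Longrightarrow> (\<lambda>p. X p f) \<in> smooth_functions A"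
  using assms by (auto simp: vector_fields_def tangent_space_def)

lemma vf_zero_vector_field: "vf_zero \<in> vector_fields A"
  by (auto simp: vf_zero_def vector_fields_def tangent_space_def smooth_functions_const)

lemma vf_add_vector_field:
  assumes "X \<in> vector_fields A" "Y \<in> vector_fields A"
  shows "vf_add X Y \<in> vector_fields A"
  using vector_fieldD[OF assms(1)] vector_fieldD[OF assms(2)]
  unfolding vf_add_def vector_fields_def tangent_space_def
  by (simp add: smooth_functions_add algebra_simps)

lemma vf_scale_vector_field:
  assumes "X \<in> vector_fields A"
  shows "vf_scale a X \<in> vector_fields A"
  using vector_fieldD[OF assms]
  unfolding vf_scale_def vector_fields_def tangent_space_def
  by (simp add: smooth_functions_scale algebra_simps)

lemma vf_bracket_vector_field:
  assumes X: "X \<in> vector_fields A" and Y: "Y \<in> vector_fields A"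
  shows "vf_bracket X Y \<in> vector_fields A"
proof -
  note rules = vector_fieldD[OF X] vector_fieldD[OF Y] smooth_functions_add smooth_functions_mult
    smooth_functions_scale
  \<comment> \<open>If \<open>f\<close> is not smooth, \<open>Y q f = 0\<close> for all
    \<open>q\<close> by the default value, so the bracket applies \<open>X\<close> to the zero
    function, and likewise with the roles exchanged. The last case below rests on this.\<close>
  have zero: "X p (\<lambda>q. 0) = 0" "Y p (\<lambda>q. 0) = 0" for p
    using vector_fieldD(2)[OF X smooth_functions_const[of 0], of p 0]
      vector_fieldD(2)[OF Y smooth_functions_const[of 0], of p 0] by simp_all
  have "vf_bracket X Y p \<in> tangent_space A p" for p
    unfolding tangent_space_def
  proof (intro CollectI conjI ballI allI impI)
    fix f g assume f: "f \<in> smooth_functions A" and g: "g \<in> smooth_functions A"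
    show "vf_bracket X Y p (\<lambda>q. f q + g q) = vf_bracket X Y p f + vf_bracket X Y p g"
      using f g by (simp add: vf_bracket_def rules)
    \<comment> \<open>The mixed products of an \<open>X\<close>-derivative and a
      \<open>Y\<close>-derivative occur in both composites and cancel.\<close>
    show "vf_bracket X Y p (\<lambda>q. f q * g q) = f p * vf_bracket X Y p g + g p * vf_bracket X Y p f"
      using f g by (simp add: vf_bracket_def rules algebra_simps)
  next
    fix a f assume "f \<in> smooth_functions A"
    then show "vf_bracket X Y p (\<lambda>q. a * f q) = a * vf_bracket X Y p f"
      by (simp add: vf_bracket_def rules algebra_simps)
  next
    fix f assume "f \<notin> smooth_functions A"
    then show "vf_bracket X Y p f = 0"
      by (simp add: vf_bracket_def rules zero)
  qed
  moreover have "(\<lambda>p. vf_bracket X Y p f) \<in> smooth_functions A" if "f \<in> smooth_functions A" for f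
    using that unfolding vf_bracket_def by (intro smooth_functions_diff rules)
  ultimately show ?thesis by (simp add: vector_fields_def)
qed

section \<open>Leading terms of composites, inverses and commutators\<close>

lemma expansion_id: "expansion I (\<lambda>t. id) k vf_zero"
  by (rule expansionI) (simp add: vf_zero_def)

text \<open>The factor \<open>b\<close> may be negative: a curve defined only for nonpositive times
  can thus be moved to nonnegative ones, with \<open>b ^ k\<close> recording a possible change of
  sign.\<close>

lemma expansion_reparametrise:
  assumes ex: "expansion I \<phi> k X" and \<theta>: "b \<noteq> 0" "l \<ge> 1" "\<And>t. t \<in> J \<Longrightarrow> b * t ^ l \<in> I"
  shows "expansion J (\<lambda>t. \<phi> (b * t ^ l)) (k * l) (vf_scale (b ^ k) X)"
proof (rule expansionI)
  fix f and p :: 'm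
  assume f: "f \<in> smooth_functions A"
  let ?\<theta> = "\<lambda>t. b * t ^ l"
  have "filterlim (\<lambda>s. (?\<theta> (fst s), snd s)) ((at 0 within I) \<times>\<^sub>F nhds p) ((at 0 within J) \<times>\<^sub>F nhds p)"
    by (intro filterlim_Pair filterlim_snd
        filterlim_compose[OF filterlim_monomial_within[OF \<theta>] filterlim_fst])
  from filterlim_compose[OF expansionD[OF ex f] this]
  have "((\<lambda>s. b ^ k * ((f (\<phi> (?\<theta> (fst s)) (snd s)) - f (snd s)) / (?\<theta> (fst s)) ^ k)) \<longlongrightarrow> b ^ k * X p f)
      ((at 0 within J) \<times>\<^sub>F nhds p)"
    by (intro tendsto_mult_left) simp
  moreover have "b ^ k * (c / (?\<theta> t) ^ k) = c / t ^ (k * l)" for c t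
    using \<theta>(1) by (simp add: power_mult_distrib mult.commute flip: power_mult)
  ultimately show "((\<lambda>s. (f (\<phi> (?\<theta> (fst s)) (snd s)) - f (snd s)) / fst s ^ (k * l)) \<longlongrightarrow>
      vf_scale (b ^ k) X p f) ((at 0 within J) \<times>\<^sub>F nhds p)"
    by (simp add: vf_scale_def)
qed

text \<open>The increment of \<open>f\<close> splits at the intermediate point
  \<open>\<psi> t q\<close>. The part due to \<open>\<phi>\<close> is its expansion evaluated at
  that moved point.\<close>

lemma expansion_compose:
  assumes I: "0 \<in> I" and \<psi>: "smooth_family A I \<psi>" "\<psi> 0 = id"
    and X: "expansion I \<phi> k X" and Y: "expansion I \<psi> k Y"
  shows "expansion I (\<lambda>t. \<phi> t \<circ> \<psi> t) k (vf_add X Y)"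
proof (rule expansionI)
  fix f and p :: 'm
  assume f: "f \<in> smooth_functions A"
  from filterlim_compose[OF expansionD[OF X f] filterlim_family[OF smooth_familyD(1)[OF \<psi>(1)] I \<psi>(2)]]
  have "((\<lambda>s. (f (\<phi> (fst s) (\<psi> (fst s) (snd s))) - f (\<psi> (fst s) (snd s))) / fst s ^ k) \<longlongrightarrow> X p f)
      ((at 0 within I) \<times>\<^sub>F nhds p)"
    by (simp add: case_prod_unfold)
  from tendsto_add[OF this expansionD[OF Y f]]
  show "((\<lambda>s. (f ((\<phi> (fst s) \<circ> \<psi> (fst s)) (snd s)) - f (snd s)) / fst s ^ k) \<longlongrightarrow> vf_add X Y p f)
      ((at 0 within I) \<times>\<^sub>F nhds p)"
    by (simp add: vf_add_def flip: add_divide_distrib)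
qed

text \<open>The expansion of \<open>\<phi>\<close>, evaluated at \<open>\<psi> t q\<close>, measures
  \<open>f q - f (\<psi> t q)\<close>, the negative of the increment sought.\<close>

lemma expansion_inverse:
  assumes I: "0 \<in> I" and \<psi>: "smooth_family A I \<psi>" "\<psi> 0 = id"
    and inverse: "\<And>t p. t \<in> I \<Longrightarrow> \<phi> t (\<psi> t p) = p"
    and X: "expansion I \<phi> k X"
  shows "expansion I \<psi> k (vf_scale (-1) X)"
proof (rule expansionI)
  fix f and p :: 'm
  assume f: "f \<in> smooth_functions A"
  from filterlim_compose[OF expansionD[OF X f] filterlim_family[OF smooth_familyD(1)[OF \<psi>(1)] I \<psi>(2)]]
  have "((\<lambda>s. - ((f (\<phi> (fst s) (\<psi> (fst s) (snd s))) - f (\<psi> (fst s) (snd s))) / fst s ^ k)) \<longlongrightarrow> - X p f)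
      ((at 0 within I) \<times>\<^sub>F nhds p)"
    by (intro tendsto_minus) (simp add: case_prod_unfold)
  then have lim: "((\<lambda>s. - ((f (\<phi> (fst s) (\<psi> (fst s) (snd s))) - f (\<psi> (fst s) (snd s))) / fst s ^ k)) \<longlongrightarrow>
      vf_scale (-1) X p f) ((at 0 within I) \<times>\<^sub>F nhds p)"
    by (simp add: vf_scale_def)
  have "\<forall>\<^sub>F s in (at 0 within I) \<times>\<^sub>F nhds p.
      - ((f (\<phi> (fst s) (\<psi> (fst s) (snd s))) - f (\<psi> (fst s) (snd s))) / fst s ^ k)
      = (f (\<psi> (fst s) (snd s)) - f (snd s)) / fst s ^ k"
    using eventually_time_nonzero[of I "nhds p"]
    by (rule eventually_mono) (auto simp: inverse minus_divide_left)
  then show "((\<lambda>s. (f (\<psi> (fst s) (snd s)) - f (snd s)) / fst s ^ k) \<longlongrightarrow> vf_scale (-1) X p f)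
      ((at 0 within I) \<times>\<^sub>F nhds p)"
    by (rule Lim_transform_eventually[OF lim])
qed

text \<open>The function \<open>f (\<phi> t q)\<close> is expanded in time up to order
  \<open>2 * k\<close>, with coefficients \<open>a i\<close>. From \<open>q\<close> to
  \<open>\<psi> t q\<close> each coefficient changes by about \<open>t ^ k\<close> times
  \<open>Y\<close> applied to it, so the term of index \<open>i\<close> contributes at order
  \<open>i + k\<close>. The term \<open>i = 0\<close> is removed by the second difference, those
  with \<open>0 < i < k\<close> vanish, and of the rest only \<open>i = k\<close>, the term
  \<open>t ^ k * X q f\<close>, contributes at order as low as \<open>2 * k\<close>.\<close>

lemma second_difference_limit:
  assumes I: "interval_about_0 I" and k: "k \<ge> 1"
    and \<phi>: "smooth_family A I \<phi>" "\<phi> 0 = id" and \<psi>: "smooth_family A I \<psi>" "\<psi> 0 = id"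
    and X: "expansion I \<phi> k X" "X \<in> vector_fields A" and Y: "expansion I \<psi> k Y" "Y \<in> vector_fields A"
    and f: "f \<in> smooth_functions A"
  shows "((\<lambda>s. (f (\<phi> (fst s) (\<psi> (fst s) (snd s))) - f (\<psi> (fst s) (snd s))
      - f (\<phi> (fst s) (snd s)) + f (snd s)) / fst s ^ (2 * k)) \<longlongrightarrow> Y p (\<lambda>q. X q f))
      ((at 0 within I) \<times>\<^sub>F nhds p)"
proof -
  let ?L = "(at 0 within I) \<times>\<^sub>F nhds p"
  have zero: "0 \<in> I" using I by (simp add: interval_about_0_def)
  note F = smooth_time_function_pullback[OF I \<phi>(1) f]
  define a where "a = (\<lambda>i q. nth_deriv I i (\<lambda>s. f (\<phi> s q)) 0)"
  define P where "P = (\<lambda>t q. \<Sum>i\<le>2*k. t ^ i / fact i * a i q)"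
  define r where "r = (\<lambda>s. (f (\<phi> (fst s) (snd s)) - P (fst s) (snd s)) / fst s ^ (2 * k))"
  \<comment> \<open>Smoothness of the coefficients allows the expansion of \<open>\<psi>\<close> to
    be applied to each of them.\<close>
  have a_smooth: "a i \<in> smooth_functions A" for i
    unfolding a_def
    by (rule smooth_time_function_smooth_functions[OF I smooth_time_function_nth_deriv[OF I F] zero])
  have a0: "a 0 = f"
    by (simp add: a_def \<phi>(2))
  have alow: "a i = (\<lambda>q. 0)" if "1 \<le> i" "i < k" for i
    using expansion_nth_deriv(1)[OF I \<phi> k X(1) f] that by (auto simp: a_def)
  have ak: "a k = (\<lambda>q. fact k * X q f)"
    using expansion_nth_deriv(2)[OF I \<phi> k X(1) f] by (auto simp: a_def)
  have r: "(r \<longlongrightarrow> 0) ?L"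
    using smooth_time_function_taylor[OF I F, of "2*k" p]
    unfolding r_def P_def a_def case_prod_unfold .
  have fam: "filterlim (\<lambda>s. (fst s, \<psi> (fst s) (snd s))) ?L ?L"
    using filterlim_family[OF smooth_familyD(1)[OF \<psi>(1)] zero \<psi>(2)] by (simp add: case_prod_unfold)
  have r\<psi>: "((\<lambda>s. r (fst s, \<psi> (fst s) (snd s))) \<longlongrightarrow> 0) ?L"
    by (rule filterlim_compose[OF r fam])
  have fstlim: "(fst \<longlongrightarrow> 0) ?L"
    by (rule filterlim_compose[OF tendsto_ident_at filterlim_fst])
  \<comment> \<open>The factor \<open>t ^ i / t ^ (2 * k)\<close> is split as
    \<open>t ^ (i - k) / t ^ k\<close>: the denominator serves the expansion of
    \<open>\<psi>\<close>, and the numerator tends to \<open>0 ^ (i - k)\<close>, which is 1 for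
    \<open>i = k\<close> and 0 above.\<close>
  have "((\<lambda>s. \<Sum>i\<in>{k..2*k}. fst s ^ (i - k) / fact i * ((a i (\<psi> (fst s) (snd s)) - a i (snd s)) / fst s ^ k)) \<longlongrightarrow>
      (\<Sum>i\<in>{k..2*k}. 0 ^ (i - k) / fact i * Y p (a i))) ?L"
    by (intro tendsto_sum tendsto_mult tendsto_divide tendsto_power fstlim tendsto_const
        expansionD[OF Y(1) a_smooth]) simp
  moreover have "(\<Sum>i\<in>{k..2*k}. 0 ^ (i - k) / fact i * Y p (a i)) = Y p (\<lambda>q. X q f)"
  proof -
    have "(\<Sum>i\<in>{k..2*k}. 0 ^ (i - k) / fact i * Y p (a i)) = (\<Sum>i\<in>{k}. 0 ^ (i - k) / fact i * Y p (a i))"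
      by (intro sum.mono_neutral_right) auto
    also have "\<dots> = Y p (\<lambda>q. X q f)"
      using vector_fieldD(2)[OF Y(2) vector_fieldD(5)[OF X(2) f], of p "fact k"] by (simp add: ak)
    finally show ?thesis .
  qed
  ultimately have "((\<lambda>s. \<Sum>i\<in>{k..2*k}. fst s ^ (i - k) / fact i * ((a i (\<psi> (fst s) (snd s)) - a i (snd s)) / fst s ^ k)) \<longlongrightarrow>
      Y p (\<lambda>q. X q f)) ?L"
    by simp
  from tendsto_add[OF this tendsto_diff[OF r\<psi> r]]
  have lim: "((\<lambda>s. (\<Sum>i\<in>{k..2*k}. fst s ^ (i - k) / fact i * ((a i (\<psi> (fst s) (snd s)) - a i (snd s)) / fst s ^ k))
      + (r (fst s, \<psi> (fst s) (snd s)) - r s)) \<longlongrightarrow> Y p (\<lambda>q. X q f)) ?L"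
    by simp
  have "(\<Sum>i\<in>{k..2*k}. t ^ (i - k) / fact i * ((a i q' - a i q) / t ^ k)) + (r (t, q') - r (t, q))
      = (f (\<phi> t q') - f q' - f (\<phi> t q) + f q) / t ^ (2 * k)" if t: "t \<noteq> 0" for t q q'
  proof -
    have alow': "i = 0 \<or> k \<le> i" if "a i q' \<noteq> a i q" for i
      using alow[of i] that by (cases "1 \<le> i \<and> i < k") auto
    have sumP: "P t q' - P t q = (f q' - f q) + (\<Sum>i\<in>{k..2*k}. t ^ i / fact i * (a i q' - a i q))"
    proof -
      have "P t q' - P t q = (\<Sum>i\<le>2*k. t ^ i / fact i * (a i q' - a i q))"
        by (simp add: P_def right_diff_distrib sum_subtractf)
      also have "\<dots> = (\<Sum>i\<in>insert 0 {k..2*k}. t ^ i / fact i * (a i q' - a i q))"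
        by (intro sum.mono_neutral_right) (auto dest: alow')
      finally show ?thesis using k by (simp add: a0)
    qed
    have "t ^ (i - k) / fact i * ((a i q' - a i q) / t ^ k) = t ^ i / fact i * (a i q' - a i q) / t ^ (2 * k)"
      if "i \<in> {k..2*k}" for i
    proof -
      have "t ^ i = t ^ (i - k) * t ^ k" "t ^ (2 * k) = t ^ k * t ^ k"
        using that by (simp_all flip: power_add add: mult_2)
      then show ?thesis using t by simp
    qed
    then have "(\<Sum>i\<in>{k..2*k}. t ^ (i - k) / fact i * ((a i q' - a i q) / t ^ k))
        = (P t q' - P t q - (f q' - f q)) / t ^ (2 * k)"
      by (simp add: sumP sum_divide_distrib)
    then show ?thesis
      by (simp add: r_def flip: add_divide_distrib diff_divide_distrib)
  qed
  then have "\<forall>\<^sub>F s in ?L. (\<Sum>i\<in>{k..2*k}. fst s ^ (i - k) / fact i * ((a i (\<psi> (fst s) (snd s)) - a i (snd s)) / fst s ^ k))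
      + (r (fst s, \<psi> (fst s) (snd s)) - r s) =
      (f (\<phi> (fst s) (\<psi> (fst s) (snd s))) - f (\<psi> (fst s) (snd s))
      - f (\<phi> (fst s) (snd s)) + f (snd s)) / fst s ^ (2 * k)"
    by (intro eventually_mono[OF eventually_time_nonzero[of I "nhds p"]]) auto
  then show ?thesis
    by (rule Lim_transform_eventually[OF lim])
qed

text \<open>Subtracting the two second differences removes \<open>f (\<phi> t q)\<close>,
  \<open>f (\<psi> t q)\<close> and \<open>f q\<close> and leaves the difference of the two
  composites. Replacing \<open>q\<close> by \<open>\<phi>' t (\<psi>' t q)\<close> turns the second
  composite into the identity. The result is \<open>vf_bracket Y X\<close> because pullback of
  functions reverses the order of composition.\<close>

lemma expansion_commutator:
  assumes I: "interval_about_0 I" and k: "k \<ge> 1"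
    and \<phi>: "smooth_family A I \<phi>" "\<phi> 0 = id" and \<psi>: "smooth_family A I \<psi>" "\<psi> 0 = id"
    and \<phi>': "smooth_family A I \<phi>'" "\<phi>' 0 = id" and \<psi>': "smooth_family A I \<psi>'" "\<psi>' 0 = id"
    and inverse: "\<And>t p. t \<in> I \<Longrightarrow> \<phi> t (\<phi>' t p) = p" "\<And>t p. t \<in> I \<Longrightarrow> \<psi> t (\<psi>' t p) = p"
    and X: "expansion I \<phi> k X" "X \<in> vector_fields A" and Y: "expansion I \<psi> k Y" "Y \<in> vector_fields A"
  shows "expansion I (\<lambda>t. \<phi> t \<circ> \<psi> t \<circ> \<phi>' t \<circ> \<psi>' t) (2 * k) (vf_bracket Y X)"
proof (rule expansionI)
  fix f and p :: 'm
  assume f: "f \<in> smooth_functions A"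
  let ?L = "(at 0 within I) \<times>\<^sub>F nhds p"
  have zero: "0 \<in> I" using I by (simp add: interval_about_0_def)
  have "((\<lambda>s. (f (\<phi> (fst s) (\<psi> (fst s) (snd s))) - f (\<psi> (fst s) (\<phi> (fst s) (snd s)))) / fst s ^ (2 * k))
      \<longlongrightarrow> Y p (\<lambda>q. X q f) - X p (\<lambda>q. Y q f)) ?L"
    using tendsto_diff[OF second_difference_limit[OF I k \<phi> \<psi> X Y f, of p]
        second_difference_limit[OF I k \<psi> \<phi> Y X f, of p]]
    by (simp flip: diff_divide_distrib)
  from filterlim_compose[OF filterlim_compose[OF this
        filterlim_family[OF smooth_familyD(1)[OF \<phi>'(1)] zero \<phi>'(2)]]
      filterlim_family[OF smooth_familyD(1)[OF \<psi>'(1)] zero \<psi>'(2)]]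
  have lim: "((\<lambda>s. (f (\<phi> (fst s) (\<psi> (fst s) (\<phi>' (fst s) (\<psi>' (fst s) (snd s)))))
      - f (\<psi> (fst s) (\<phi> (fst s) (\<phi>' (fst s) (\<psi>' (fst s) (snd s)))))) / fst s ^ (2 * k))
      \<longlongrightarrow> vf_bracket Y X p f) ?L"
    by (simp add: case_prod_unfold vf_bracket_def)
  show "((\<lambda>s. (f ((\<phi> (fst s) \<circ> \<psi> (fst s) \<circ> \<phi>' (fst s) \<circ> \<psi>' (fst s)) (snd s)) - f (snd s)) / fst s ^ (2 * k))
      \<longlongrightarrow> vf_bracket Y X p f) ?L"
    by (rule Lim_transform_eventually[OF lim],
        rule eventually_mono[OF eventually_time_nonzero[of I "nhds p"]]) (auto simp: inverse)
qed

end

section \<open>Fields generated by a group of diffeomorphisms\<close>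

lemma interval_about_0_Icc: "0 < d \<Longrightarrow> interval_about_0 {0..d}"
  unfolding interval_about_0_def by (auto simp: is_interval_cc)

lemma vf_scale_scale: "vf_scale a (vf_scale b X) = vf_scale (a * b) X"
  and vf_scale_1: "vf_scale 1 X = X"
  and vf_scale_0: "vf_scale 0 X = vf_zero"
  by (simp_all add: vf_scale_def vf_zero_def mult.assoc)

lemma subgroup_diff_groupD:
  assumes G: "subgroup G (diff_group A)"
  shows "\<phi> \<in> G \<Longrightarrow> \<phi> \<in> carrier (diff_group A)" and "id \<in> G"
    and "\<lbrakk>\<phi> \<in> G; \<psi> \<in> G\<rbrakk> \<Longrightarrow> \<phi> \<circ> \<psi> \<in> G"
    and "\<phi> \<in> G \<Longrightarrow> inv_into UNIV \<phi> \<in> G"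
proof -
  show carrier: "\<phi> \<in> G \<Longrightarrow> \<phi> \<in> carrier (diff_group A)" for \<phi>
    using subgroup.subset[OF G] by blast
  show "id \<in> G"
    using subgroup.one_closed[OF G] by (simp add: diff_group_def)
  show "\<lbrakk>\<phi> \<in> G; \<psi> \<in> G\<rbrakk> \<Longrightarrow> \<phi> \<circ> \<psi> \<in> G"
    using subgroup.m_closed[OF G, of \<phi> \<psi>] by (simp add: diff_group_def)
  assume \<phi>: "\<phi> \<in> G"
  have bij: "bij \<phi>" and smooth: "smooth_map A \<phi>" "smooth_map A (inv_into UNIV \<phi>)"
    using carrier[OF \<phi>] by (auto simp: diff_group_def)
  \<comment> \<open>\<open>m_inv\<close> is a definite description, so besides the witness its
    uniqueness among two-sided inverses has to be shown.\<close>
  have "m_inv (diff_group A) \<phi> = inv_into UNIV \<phi>"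
    unfolding m_inv_def
  proof (rule the_equality)
    show "inv_into UNIV \<phi> \<in> carrier (diff_group A) \<and>
      \<phi> \<otimes>\<^bsub>diff_group A\<^esub> inv_into UNIV \<phi> = \<one>\<^bsub>diff_group A\<^esub> \<and>
      inv_into UNIV \<phi> \<otimes>\<^bsub>diff_group A\<^esub> \<phi> = \<one>\<^bsub>diff_group A\<^esub>"
      using bij smooth
      by (auto simp: diff_group_def bij_imp_bij_inv inv_inv_eq fun_eq_iff bij_is_inj bij_is_surj surj_f_inv_f)
    fix \<psi> assume "\<psi> \<in> carrier (diff_group A) \<and> \<phi> \<otimes>\<^bsub>diff_group A\<^esub> \<psi> = \<one>\<^bsub>diff_group A\<^esub> \<and>
      \<psi> \<otimes>\<^bsub>diff_group A\<^esub> \<phi> = \<one>\<^bsub>diff_group A\<^esub>"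
    then have "\<psi> \<circ> \<phi> = id" "\<phi> \<circ> \<psi> = id" by (simp_all add: diff_group_def)
    then show "\<psi> = inv_into UNIV \<phi>"
      by (metis inv_unique_comp)
  qed
  then show "inv_into UNIV \<phi> \<in> G"
    using subgroup.m_inv_closed[OF G \<phi>] by simp
qed

context smooth_manifold
begin

text \<open>Here \<open>X\<close> is the leading Taylor coefficient, so the k-th derivative at 0 is
  \<open>fact k\<close> times \<open>X\<close>; this keeps factorials out of sums and commutators.
  The interval is compact, as the smoothness of inverse families requires, and one-sided, so that
  time changes \<open>b * t ^ l\<close> with positive \<open>b\<close> map such intervals into each
  other.\<close>

definition generates :: "('m \<Rightarrow> 'm) set \<Rightarrow> real \<Rightarrow> nat \<Rightarrow> 'm vfield \<Rightarrow> bool" where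
  "generates G d k X \<longleftrightarrow> (\<exists>\<phi>. smooth_family A {0..d} \<phi> \<and> (\<forall>t\<in>{0..d}. \<phi> t \<in> G) \<and> \<phi> 0 = id \<and>
     expansion {0..d} \<phi> k X)"

lemma generatesI:
  assumes "smooth_family A {0..d} \<phi>" "\<And>t. t \<in> {0..d} \<Longrightarrow> \<phi> t \<in> G" "\<phi> 0 = id" "expansion {0..d} \<phi> k X"
  shows "generates G d k X"
  using assms by (auto simp: generates_def)

lemma generates_reparametrise:
  assumes X: "generates G d k X" and d': "0 < d'" and b: "0 < b" "l \<ge> 1" "b * d' ^ l \<le> d"
  shows "generates G d' (k * l) (vf_scale (b ^ k) X)"
proof -
  obtain \<phi> where \<phi>: "smooth_family A {0..d} \<phi>" "\<forall>t\<in>{0..d}. \<phi> t \<in> G" "\<phi> 0 = id"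
    "expansion {0..d} \<phi> k X"
    using X by (auto simp: generates_def)
  note J = interval_about_0_Icc[OF d']
  have \<theta>: "b * t ^ l \<in> {0..d}" if "t \<in> {0..d'}" for t
  proof -
    have "b * t ^ l \<le> b * d' ^ l"
      using that b by (intro mult_left_mono power_mono) auto
    then have "b * t ^ l \<le> d" using b(3) by simp
    then show ?thesis using that b(1) by simp
  qed
  have "smooth_family A {0..d'} (\<lambda>t. \<phi> (b * t ^ l))"
    by (rule smooth_family_reparametrise[OF J \<phi>(1) smooth_on_monomial[OF accessible_interval[OF J]]])
      (use \<theta> in auto)
  moreover have "expansion {0..d'} (\<lambda>t. \<phi> (b * t ^ l)) (k * l) (vf_scale (b ^ k) X)"
    by (rule expansion_reparametrise[OF \<phi>(4)]) (use \<theta> b in auto)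
  moreover have "\<phi> (b * 0 ^ l) = id"
    using \<phi>(3) b(2) by (simp add: power_0_left)
  ultimately show ?thesis
    unfolding generates_def using \<phi>(2) \<theta> by blast
qed

lemma generates_shrink:
  assumes "generates G d k X" "0 < d'" "d' \<le> d"
  shows "generates G d' k X"
  using generates_reparametrise[OF assms(1,2), of 1 1] assms(3) by (simp add: vf_scale_1)

lemma generates_scale_pos:
  assumes X: "generates G d k X" and d: "0 < d" and k: "k \<ge> 1" and a: "0 < a"
  obtains d' where "0 < d'" "generates G d' k (vf_scale a X)"
proof -
  \<comment> \<open>Time is multiplied by the k-th root of \<open>a\<close>; the length
    \<open>d / b\<close> is the one that this multiplication takes to \<open>d\<close>.\<close>
  define b where "b = root k a"
  have b: "0 < b" "b ^ k = a"
    using k a by (simp_all add: b_def real_root_pow_pos2)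
  show ?thesis
    using that[of "d / b"] generates_reparametrise[OF X, of "d / b" b 1] b d by simp
qed

lemma generates_order_mult:
  assumes X: "generates G d k X" and d: "0 < d" and l: "l \<ge> 1"
  obtains d' where "0 < d'" "generates G d' (k * l) X"
proof -
  \<comment> \<open>On the unit interval \<open>t ^ l\<close> does not exceed \<open>t\<close>, so
    capping the length at 1 keeps the new time within \<open>{0..d}\<close>.\<close>
  have "(min d 1) ^ l \<le> min d 1"
    using d l power_decreasing[of 1 l "min d 1"] by simp
  then have "1 * (min d 1) ^ l \<le> d" by simp
  then have "generates G (min d 1) (k * l) X"
    using generates_reparametrise[OF X, of "min d 1" 1 l] d l by (simp add: vf_scale_1)
  then show ?thesis using that[of "min d 1"] d by simp
qed

end

section \<open>Closure of the generated fields under the Lie algebra operations\<close>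

locale diffeomorphism_subgroup = smooth_manifold A
  for A :: "('m::t2_space, 'e::euclidean_space) chart set" +
  fixes G :: "('m \<Rightarrow> 'm) set"
  assumes compact: "compact (UNIV :: 'm set)"
    and subgroup: "subgroup G (diff_group A)"
begin

lemmas G_rules = subgroup_diff_groupD[OF subgroup]

lemma inverse_family:
  assumes d: "0 < d" and \<phi>: "smooth_family A {0..d} \<phi>" "\<And>t. t \<in> {0..d} \<Longrightarrow> \<phi> t \<in> G" "\<phi> 0 = id"
  defines "\<psi> \<equiv> \<lambda>t. inv_into UNIV (\<phi> t)"
  shows "smooth_family A {0..d} \<psi>" "t \<in> {0..d} \<Longrightarrow> \<psi> t \<in> G" "\<psi> 0 = id"
    and "t \<in> {0..d} \<Longrightarrow> \<phi> t (\<psi> t p) = p"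
proof -
  have "smooth_diff_curve A {0..d} \<phi>"
    using \<phi> G_rules(1) by (simp add: smooth_diff_curve_iff)
  then show "smooth_family A {0..d} \<psi>"
    unfolding \<psi>_def by (rule smooth_family_inverse[OF compact compact_Icc interval_about_0_Icc[OF d]])
  show "t \<in> {0..d} \<Longrightarrow> \<psi> t \<in> G"
    using \<phi>(2) G_rules(4) by (simp add: \<psi>_def)
  show "\<psi> 0 = id"
    using \<phi>(3) by (simp add: \<psi>_def)
  assume "t \<in> {0..d}"
  then have "bij (\<phi> t)"
    using \<phi>(2) G_rules(1) by (auto simp: diff_group_def)
  then show "\<phi> t (\<psi> t p) = p"
    by (simp add: \<psi>_def bij_is_surj surj_f_inv_f)
qed

lemma generates_zero: "generates G 1 k vf_zero"
  by (rule generatesI[OF smooth_family_id[OF interval_about_0_Icc] _ _ expansion_id])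
    (simp_all add: G_rules(2))

lemma generates_uminus:
  assumes d: "0 < d" and X: "generates G d k X"
  shows "generates G d k (vf_scale (-1) X)"
proof -
  obtain \<phi> where \<phi>: "smooth_family A {0..d} \<phi>" "\<And>t. t \<in> {0..d} \<Longrightarrow> \<phi> t \<in> G" "\<phi> 0 = id"
    "expansion {0..d} \<phi> k X"
    using X by (auto simp: generates_def)
  note \<psi> = inverse_family[OF d \<phi>(1-3)]
  have ex: "expansion {0..d} (\<lambda>t. inv_into UNIV (\<phi> t)) k (vf_scale (-1) X)"
    by (rule expansion_inverse[OF _ \<psi>(1,3,4) \<phi>(4)]) (use d in auto)
  show ?thesis
    by (rule generatesI[OF \<psi>(1,2,3) ex])
qed

lemma generates_scale:
  assumes d: "0 < d" and k: "k \<ge> 1" and X: "generates G d k X"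
  obtains d' where "0 < d'" "generates G d' k (vf_scale a X)"
proof -
  consider "a = 0" | "a > 0" | "a < 0" by linarith
  then show ?thesis
  proof cases
    case 1
    then show ?thesis using that[of 1] generates_zero by (simp add: vf_scale_0)
  next
    case 2
    then obtain d' where "0 < d'" "generates G d' k (vf_scale a X)"
      by (rule generates_scale_pos[OF X d k])
    then show ?thesis by (rule that)
  next
    case 3
    \<comment> \<open>A time change with positive \<open>b\<close> yields positive factors only, so
      the sign is supplied by the inverse family, which generates
      \<open>vf_scale (-1) X\<close>.\<close>
    then have "0 < - a" by simp
    then obtain d' where "0 < d'" "generates G d' k (vf_scale (- a) (vf_scale (-1) X))"
      by (rule generates_scale_pos[OF generates_uminus[OF d X] d k])
    then show ?thesis using that by (simp add: vf_scale_scale)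
  qed
qed

lemma generates_add:
  assumes d: "0 < d" and X: "generates G d k X" and Y: "generates G d k Y"
  shows "generates G d k (vf_add X Y)"
proof -
  obtain \<phi> where \<phi>: "smooth_family A {0..d} \<phi>" "\<And>t. t \<in> {0..d} \<Longrightarrow> \<phi> t \<in> G" "\<phi> 0 = id"
    "expansion {0..d} \<phi> k X"
    using X by (auto simp: generates_def)
  obtain \<psi> where \<psi>: "smooth_family A {0..d} \<psi>" "\<And>t. t \<in> {0..d} \<Longrightarrow> \<psi> t \<in> G" "\<psi> 0 = id"
    "expansion {0..d} \<psi> k Y"
    using Y by (auto simp: generates_def)
  have "expansion {0..d} (\<lambda>t. \<phi> t \<circ> \<psi> t) k (vf_add X Y)"
    by (rule expansion_compose[OF _ \<psi>(1,3) \<phi>(4) \<psi>(4)]) (use d in auto)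
  then show ?thesis
    by (rule generatesI[OF smooth_family_compose[OF interval_about_0_Icc[OF d] \<phi>(1) \<psi>(1)], rotated 2])
      (simp_all add: \<phi>(2,3) \<psi>(2,3) G_rules(3))
qed

lemma generates_bracket:
  assumes d: "0 < d" and k: "k \<ge> 1" and X: "generates G d k X" "X \<in> vector_fields A"
    and Y: "generates G d k Y" "Y \<in> vector_fields A"
  shows "generates G d (2 * k) (vf_bracket Y X)"
proof -
  obtain \<phi> where \<phi>: "smooth_family A {0..d} \<phi>" "\<And>t. t \<in> {0..d} \<Longrightarrow> \<phi> t \<in> G" "\<phi> 0 = id"
    "expansion {0..d} \<phi> k X"
    using X by (auto simp: generates_def)
  obtain \<psi> where \<psi>: "smooth_family A {0..d} \<psi>" "\<And>t. t \<in> {0..d} \<Longrightarrow> \<psi> t \<in> G" "\<psi> 0 = id"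
    "expansion {0..d} \<psi> k Y"
    using Y by (auto simp: generates_def)
  define \<phi>' where "\<phi>' = (\<lambda>t. inv_into UNIV (\<phi> t))"
  define \<psi>' where "\<psi>' = (\<lambda>t. inv_into UNIV (\<psi> t))"
  have \<phi>': "smooth_family A {0..d} \<phi>'" "\<And>t. t \<in> {0..d} \<Longrightarrow> \<phi>' t \<in> G" "\<phi>' 0 = id"
    "\<And>t p. t \<in> {0..d} \<Longrightarrow> \<phi> t (\<phi>' t p) = p"
    using inverse_family[OF d \<phi>(1-3)] by (simp_all add: \<phi>'_def)
  have \<psi>': "smooth_family A {0..d} \<psi>'" "\<And>t. t \<in> {0..d} \<Longrightarrow> \<psi>' t \<in> G" "\<psi>' 0 = id"
    "\<And>t p. t \<in> {0..d} \<Longrightarrow> \<psi> t (\<psi>' t p) = p"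
    using inverse_family[OF d \<psi>(1-3)] by (simp_all add: \<psi>'_def)
  note I = interval_about_0_Icc[OF d]
  have "smooth_family A {0..d} (\<lambda>t. \<phi> t \<circ> \<psi> t \<circ> \<phi>' t \<circ> \<psi>' t)"
    by (intro smooth_family_compose[OF I] \<phi> \<psi> \<phi>' \<psi>')
  moreover have "\<phi> t \<circ> \<psi> t \<circ> \<phi>' t \<circ> \<psi>' t \<in> G" if "t \<in> {0..d}" for t
    using that by (intro G_rules(3) \<phi> \<psi> \<phi>' \<psi>')
  moreover have "expansion {0..d} (\<lambda>t. \<phi> t \<circ> \<psi> t \<circ> \<phi>' t \<circ> \<psi>' t) (2 * k) (vf_bracket Y X)"
    by (rule expansion_commutator[OF I k \<phi>(1,3) \<psi>(1,3) \<phi>'(1,3) \<psi>'(1,3) \<phi>'(4) \<psi>'(4) \<phi>(4) X(2) \<psi>(4) Y(2)])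
  ultimately show ?thesis
    by (intro generatesI[where \<phi> = "\<lambda>t. \<phi> t \<circ> \<psi> t \<circ> \<phi>' t \<circ> \<psi>' t"])
      (simp_all add: \<phi>(3) \<psi>(3) \<phi>'(3) \<psi>'(3))
qed

text \<open>Two normalisations are reconciled: an arbitrary interval with k-th derivative
  \<open>X\<close>, and \<open>{0..d}\<close> with leading coefficient \<open>X\<close>. They differ
  by a nonzero factor, which \<open>generates_scale\<close> absorbs.\<close>

lemma tangent_fields_iff:
  "X \<in> tangent_fields A G \<longleftrightarrow> X \<in> vector_fields A \<and> (\<exists>d>0. \<exists>k\<ge>1. generates G d k X)"
proof (intro iffI conjI)
  assume *: "X \<in> tangent_fields A G"
  then show X: "X \<in> vector_fields A" by (simp add: tangent_fields_def)
  obtain I \<phi> where curve: "integral_curve A I \<phi> X" and G: "\<forall>t\<in>I. \<phi> t \<in> G"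
    using * by (auto simp: tangent_fields_def)
  have I: "interval_about_0 I" and fam: "smooth_family A I \<phi>" and \<phi>0: "\<phi> 0 = id"
    using curve by (auto simp: integral_curve_def smooth_diff_curve_iff)
  obtain k where k: "k \<ge> 1" "expansion I \<phi> k (vf_scale (1 / fact k) X)"
    by (rule integral_curve_expansion[OF curve X])
  \<comment> \<open>If \<open>I\<close> contains no positive times, \<open>c\<close> is negative;
    the curve is then run backwards and the factor \<open>c ^ k\<close> can be negative too.\<close>
  obtain c where c: "c \<in> I" "c \<noteq> 0"
    using I by (auto simp: interval_about_0_def)
  have \<theta>: "c * t ^ 1 \<in> I" if "t \<in> {0..1}" for t
  proof -
    have "c * t \<in> closed_segment 0 c"
      using that by (auto simp: closed_segment_def mult.commute)
    then show ?thesis using interval_about_0_closed_segment[OF I c(1)] by auto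
  qed
  note J = interval_about_0_Icc[OF zero_less_one]
  have "smooth_family A {0..1} (\<lambda>t. \<phi> (c * t ^ 1))"
    by (rule smooth_family_reparametrise[OF J fam smooth_on_monomial[OF accessible_interval[OF J]]])
      (use \<theta> in blast)
  moreover have "expansion {0..1} (\<lambda>t. \<phi> (c * t ^ 1)) (k * 1) (vf_scale (c ^ k) (vf_scale (1 / fact k) X))"
    by (rule expansion_reparametrise[OF k(2) c(2) _ \<theta>]) simp_all
  moreover have "\<phi> (c * t ^ 1) \<in> G" if "t \<in> {0..1}" for t
    using G \<theta>[OF that] by blast
  moreover have "\<phi> (c * 0 ^ 1) = id"
    using \<phi>0 by simp
  ultimately have gen: "generates G 1 (k * 1) (vf_scale (c ^ k) (vf_scale (1 / fact k) X))"
    by (intro generatesI[where \<phi> = "\<lambda>t. \<phi> (c * t ^ 1)"])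
  have "1 \<le> k * 1" using k(1) by simp
  \<comment> \<open>The factor \<open>fact k / c ^ k\<close> undoes both rescalings; its sign is
    that of \<open>c ^ k\<close>.\<close>
  then obtain d where d: "0 < d"
    "generates G d (k * 1) (vf_scale (fact k / c ^ k) (vf_scale (c ^ k) (vf_scale (1 / fact k) X)))"
    by (rule generates_scale[OF zero_less_one _ gen])
  have "fact k / c ^ k * (c ^ k * (1 / fact k)) = 1"
    using c(2) by simp
  then have "generates G d k X"
    using d(2) by (simp only: vf_scale_scale vf_scale_1 mult_1_right)
  then show "\<exists>d>0. \<exists>k\<ge>1. generates G d k X"
    using k(1) d(1) by blast
next
  assume "X \<in> vector_fields A \<and> (\<exists>d>0. \<exists>k\<ge>1. generates G d k X)"
  then obtain d k where X: "X \<in> vector_fields A" and d: "0 < d" and k: "k \<ge> 1" and gen: "generates G d k X"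
    by blast
  obtain d' where d': "0 < d'" "generates G d' k (vf_scale (1 / fact k) X)"
    by (rule generates_scale[OF d k gen])
  then obtain \<phi> where \<phi>: "smooth_family A {0..d'} \<phi>" "\<And>t. t \<in> {0..d'} \<Longrightarrow> \<phi> t \<in> G" "\<phi> 0 = id"
    "expansion {0..d'} \<phi> k (vf_scale (1 / fact k) X)"
    by (auto simp: generates_def)
  have "smooth_diff_curve A {0..d'} \<phi>"
    using \<phi> G_rules(1) by (simp add: smooth_diff_curve_iff)
  then have "integral_curve A {0..d'} \<phi> X"
    by (rule expansion_integral_curve[OF interval_about_0_Icc[OF d'(1)] _ \<phi>(3) k X \<phi>(4)])
  then show "X \<in> tangent_fields A G"
    unfolding tangent_fields_def using X \<phi>(2) by blast
qed

text \<open>Orders are matched at the common multiple \<open>k1 * k2\<close>, each curve being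
  slowed down by the order of the other.\<close>

lemma common_generator:
  assumes "X \<in> tangent_fields A G" "Y \<in> tangent_fields A G"
  obtains d k where "0 < d" "k \<ge> 1" "generates G d k X" "generates G d k Y"
proof -
  obtain d1 k1 where X: "0 < d1" "k1 \<ge> 1" "generates G d1 k1 X"
    using assms(1) tangent_fields_iff by blast
  obtain d2 k2 where Y: "0 < d2" "k2 \<ge> 1" "generates G d2 k2 Y"
    using assms(2) tangent_fields_iff by blast
  obtain e1 where e1: "0 < e1" "generates G e1 (k1 * k2) X"
    by (rule generates_order_mult[OF X(3,1) Y(2)])
  obtain e2 where e2: "0 < e2" "generates G e2 (k2 * k1) Y"
    by (rule generates_order_mult[OF Y(3,1) X(2)])
  show ?thesis
  proof (rule that)
    show "0 < min e1 e2" using e1 e2 by simp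
    show "1 \<le> k1 * k2" using X(2) Y(2) by simp
    show "generates G (min e1 e2) (k1 * k2) X"
      using generates_shrink[OF e1(2)] e1(1) e2(1) by simp
    show "generates G (min e1 e2) (k1 * k2) Y"
      using generates_shrink[OF e2(2)] e1(1) e2(1) by (simp add: mult.commute)
  qed
qed

lemma lie_subalgebra_tangent_fields: "lie_subalgebra A (tangent_fields A G)"
  unfolding lie_subalgebra_def
proof (intro conjI ballI allI)
  show "tangent_fields A G \<subseteq> vector_fields A"
    by (auto simp: tangent_fields_def)
  show "vf_zero \<in> tangent_fields A G"
    unfolding tangent_fields_iff using generates_zero[of 1] vf_zero_vector_field zero_less_one by blast
next
  fix X Y assume X: "X \<in> tangent_fields A G" and Y: "Y \<in> tangent_fields A G"
  then have vf: "X \<in> vector_fields A" "Y \<in> vector_fields A"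
    by (auto simp: tangent_fields_def)
  obtain d k where gen: "0 < d" "k \<ge> 1" "generates G d k X" "generates G d k Y"
    by (rule common_generator[OF X Y])
  show "vf_add X Y \<in> tangent_fields A G"
    unfolding tangent_fields_iff
    using generates_add[OF gen(1,3,4)] gen(1,2) vf_add_vector_field[OF vf] by blast
  \<comment> \<open>\<open>generates_bracket\<close> returns the bracket with its fields reversed,
    so \<open>X\<close> and \<open>Y\<close> are passed in exchanged roles.\<close>
  have "generates G d (2 * k) (vf_bracket X Y)"
    by (rule generates_bracket[OF gen(1,2,4) vf(2) gen(3) vf(1)])
  moreover have "1 \<le> 2 * k" using gen(2) by simp
  ultimately show "vf_bracket X Y \<in> tangent_fields A G"
    unfolding tangent_fields_iff using gen(1) vf_bracket_vector_field[OF vf] by blast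
next
  fix a X assume "X \<in> tangent_fields A G"
  then obtain d k where X: "X \<in> vector_fields A" "0 < d" "k \<ge> 1" "generates G d k X"
    using tangent_fields_iff by blast
  obtain d' where "0 < d'" "generates G d' k (vf_scale a X)"
    by (rule generates_scale[OF X(2-4)])
  then show "vf_scale a X \<in> tangent_fields A G"
    unfolding tangent_fields_iff using X(3) vf_scale_vector_field[OF X(1)] by blast
qed

end

theorem theorem3p4:
  fixes A :: "('m::{second_countable_topology, t2_space}, 'e::euclidean_space) chart set"
    and G :: "('m \<Rightarrow> 'm) set"
  assumes "smooth_atlas A"
    and "compact (UNIV :: 'm set)"
    and "subgroup G (diff_group A)"
  shows "lie_subalgebra A (tangent_fields A G)"
proof -
  interpret diffeomorphism_subgroup A G
    by (intro diffeomorphism_subgroup.intro diffeomorphism_subgroup_axioms.intro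
        smooth_manifold.intro assms)
  show ?thesis by (rule lie_subalgebra_tangent_fields)
qed

end
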